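(* Suppose that all the roots of $\Delta$ have the same length (the simply-laced, or ADE, case). Let $\mathfrak a$ be any maximal abelian ideal of $\mathfrak b$, with set of roots $I(\mathfrak a)\subset\Delta^+$, and let $\alpha\in\Pi$ be the simple root corresponding to $\mathfrak a$ (i.e. $I(\mathfrak a)=I(\alpha)_{max}$). For $\gamma\in I(\mathfrak a)$ put $\tilde w_\gamma=\sigma_\alpha w_{\gamma,\alpha}$, where $w_{\gamma,\alpha}$ is the unique element of minimal length in $W$ taking $\gamma$ to $\alpha$. Then $\mathcal F_{\mathfrak a}=\{\tilde w_\gamma\mid \gamma\in I(\mathfrak a)\}$ is a minimal inversion complete set in $W$. In particular, $\#\mathcal F_{\mathfrak a}=\dim\mathfrak a=\# I(\mathfrak a)$. Furthermore, $\mathsf{Ess}(\mathcal F_{\mathfrak a})\supset I(\mathfrak a)$.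
   Context: Let $\mathfrak g$ be a simple complex Lie algebra with triangular decomposition $\mathfrak g=\mathfrak u^-\oplus\mathfrak t\oplus\mathfrak u^+$, $\mathfrak b=\mathfrak t\oplus\mathfrak u^+$ the Borel subalgebra, $\Delta$ the (irreducible, reduced, crystallographic) root system of $(\mathfrak g,\mathfrak t)$ in the real Euclidean space $V$, $\Delta^+$ the positive roots (the roots of $\mathfrak u^+$), $\Pi$ the simple roots, $\theta$ the highest root, $W$ the Weyl group, $\sigma_\gamma$ the reflection in $\gamma$, $\gamma^\vee=2\gamma/(\gamma,\gamma)$; length in $W$ is with respect to the simple reflections. $\gamma\succcurlyeq\mu$ means that $\gamma-\mu$ is a nonnegative integer combination of simple roots. For $w\in W$, $\mathcal N(w)=\{\gamma\in\Delta^+\mid w(\gamma)\in-\Delta^+\}$. A subset $\mathcal F\subset W$ is a minimal inversion complete set if $\bigcup_{w\in\mathcal F}\mathcal N(w)=\Delta^+$ and the equality fails for any proper subset of $\mathcal F$. $\mathsf{Ess}(\mathcal F)$ is the set of $\gamma\in\Delta^+$ such that there is a unique $w\in\mathcal F$ with $\gamma\in\mathcal N(w)$ (the essential roots). Every abelian ideal $\mathfrak a$ of $\mathfrak b$ has the form $\bigoplus_{\gamma\in I(\mathfrak a)}\mathfrak g_\gamma$ with $I(\mathfrak a)\subset\Delta^+$; abelian ideals are identified with their sets of roots, i.e. with subsets $I\subset\Delta^+$ such that (1) $\gamma\in I$, $\nu\in\Delta^+$, $\gamma+\nu\in\Delta$ imply $\gamma+\nu\in I$; (2) $\gamma+\gamma'\notin\Delta$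 for $\gamma,\gamma'\in I$. Correspondence between maximal abelian ideals and simple roots (known). Let $\delta$ be the basic imaginary root, $\alpha_0=\delta-\theta$ the additional affine simple root, $\widehat W$ the affine Weyl group generated by $W$ and the reflection $\sigma_0$ in $\alpha_0$, acting on the real affine roots $\Delta+\mathbb Z\delta$ (positive ones: $\nu+k\delta$ with $k>0$, or $k=0$ and $\nu\in\Delta^+$). For each nonzero abelian ideal $I$ there is a unique $w_I\in\widehat W$ whose set of inversions (positive real affine roots sent to negative ones) is $\{\delta-\gamma\mid\gamma\in I\}$, and $\tau(I):=w_I(\alpha_0)+\delta$ is a long positive root. Each fibre $\tau^{-1}(\mu)$ ($\mu$ a long positive root) has a unique maximal element $I(\mu)_{max}$ with respect to inclusion. For long simple $\alpha$ the ideals $I(\alpha)_{max}$ are exactly the maximal abelian ideals, and $\alpha\mapsto I(\alpha)_{max}$ is a bijection; in the simply-laced case all simple roots are long. It is known that $\gamma\succcurlyeq\alpha$ for every $\gamma\in I(\alpha)_{max}$, and that for $\gamma\succcurlyeq\alpha$ of the same length as $\alpha$ (long) the element of minimal length in $W$ taking $\gamma$ to $\alpha$ is unique. *)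

theory Defs
  imports "HOL-Analysis.Analysis"
begin

section \<open>Root systems, bases and Weyl groups\<close>

definition refl :: "'v::euclidean_space \<Rightarrow> 'v \<Rightarrow> 'v" where
  "refl \<gamma> v = v - (2 * (v \<bullet> \<gamma>) / (\<gamma> \<bullet> \<gamma>)) *\<^sub>R \<gamma>"

text \<open>Irreducible, reduced, crystallographic root systems spanning the Euclidean space.\<close>

definition root_system :: "'v::euclidean_space set \<Rightarrow> bool" where
  "root_system \<Delta> \<longleftrightarrow>
     finite \<Delta> \<and> 0 \<notin> \<Delta> \<and> span \<Delta> = UNIV \<and>
     (\<forall>\<gamma>\<in>\<Delta>. refl \<gamma> ` \<Delta> \<subseteq> \<Delta>) \<and>
     (\<forall>\<gamma>\<in>\<Delta>. \<forall>\<nu>\<in>\<Delta>. 2 * (\<nu> \<bullet> \<gamma>) / (\<gamma> \<bullet> \<gamma>) \<in> \<int>) \<and>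
     (\<forall>\<gamma>\<in>\<Delta>. \<forall>c::real. c *\<^sub>R \<gamma> \<in> \<Delta> \<longrightarrow> c = 1 \<or> c = -1) \<and>
     \<Delta> \<noteq> {} \<and>
     \<not> (\<exists>X Y. X \<noteq> {} \<and> Y \<noteq> {} \<and> X \<union> Y = \<Delta> \<and> (\<forall>x\<in>X. \<forall>y\<in>Y. x \<bullet> y = 0))"

definition simply_laced :: "'v::euclidean_space set \<Rightarrow> bool" where
  "simply_laced \<Delta> \<longleftrightarrow> (\<forall>\<gamma>\<in>\<Delta>. \<forall>\<nu>\<in>\<Delta>. norm \<gamma> = norm \<nu>)"

text \<open>\<open>root_ge B \<gamma> \<mu>\<close>: the difference \<open>\<gamma> - \<mu>\<close> is a nonnegative integer combination of
  elements of \<open>B\<close>.\<close>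

definition root_ge :: "'v::euclidean_space set \<Rightarrow> 'v \<Rightarrow> 'v \<Rightarrow> bool" where
  "root_ge B \<gamma> \<mu> \<longleftrightarrow> (\<exists>c :: 'v \<Rightarrow> nat. \<gamma> - \<mu> = (\<Sum>\<beta>\<in>B. real (c \<beta>) *\<^sub>R \<beta>))"

text \<open>The set of simple roots is called \<open>B\<close>, since the letter \<open>Pi\<close> is a binder.\<close>

definition simple_roots :: "'v::euclidean_space set \<Rightarrow> 'v set \<Rightarrow> bool" where
  "simple_roots \<Delta> B \<longleftrightarrow>
     B \<subseteq> \<Delta> \<and> independent B \<and> (\<forall>\<gamma>\<in>\<Delta>. root_ge B \<gamma> 0 \<or> root_ge B 0 \<gamma>)"

definition pos_roots :: "'v::euclidean_space set \<Rightarrow> 'v set \<Rightarrow> 'v set" where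
  "pos_roots \<Delta> B = {\<gamma>\<in>\<Delta>. root_ge B \<gamma> 0}"

definition highest_root :: "'v::euclidean_space set \<Rightarrow> 'v set \<Rightarrow> 'v \<Rightarrow> bool" where
  "highest_root \<Delta> B \<theta> \<longleftrightarrow> \<theta> \<in> \<Delta> \<and> (\<forall>\<gamma>\<in>\<Delta>. root_ge B \<theta> \<gamma>)"

text \<open>The monoid of self-maps generated by \<open>S\<close>. It is only used for sets \<open>S\<close> closed under
  inverses, where it is the group generated by \<open>S\<close>.\<close>

inductive_set gen_maps :: "('x \<Rightarrow> 'x) set \<Rightarrow> ('x \<Rightarrow> 'x) set" for S where
  gen_id: "id \<in> gen_maps S"
| gen_step: "s \<in> S \<Longrightarrow> w \<in> gen_maps S \<Longrightarrow> s \<circ> w \<in> gen_maps S"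

definition weyl :: "'v::euclidean_space set \<Rightarrow> ('v \<Rightarrow> 'v) set" where
  "weyl \<Delta> = gen_maps (refl ` \<Delta>)"

definition weyl_length :: "'v::euclidean_space set \<Rightarrow> ('v \<Rightarrow> 'v) \<Rightarrow> nat" where
  "weyl_length B w =
     (LEAST n. \<exists>\<beta>s. set \<beta>s \<subseteq> B \<and> length \<beta>s = n \<and> w = foldr (\<circ>) (map refl \<beta>s) id)"

definition inversions :: "'v::euclidean_space set \<Rightarrow> 'v set \<Rightarrow> ('v \<Rightarrow> 'v) \<Rightarrow> 'v set" where
  "inversions \<Delta> B w = {\<gamma> \<in> pos_roots \<Delta> B. w \<gamma> \<in> uminus ` pos_roots \<Delta> B}"

definition min_inv_complete :: "'v::euclidean_space set \<Rightarrow> 'v set \<Rightarrow> ('v \<Rightarrow> 'v) set \<Rightarrow> bool" where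
  "min_inv_complete \<Delta> B F \<longleftrightarrow>
     F \<subseteq> weyl \<Delta> \<and> (\<Union>w\<in>F. inversions \<Delta> B w) = pos_roots \<Delta> B \<and>
     (\<forall>F'. F' \<subset> F \<longrightarrow> (\<Union>w\<in>F'. inversions \<Delta> B w) \<noteq> pos_roots \<Delta> B)"

definition Ess :: "'v::euclidean_space set \<Rightarrow> 'v set \<Rightarrow> ('v \<Rightarrow> 'v) set \<Rightarrow> 'v set" where
  "Ess \<Delta> B F = {\<gamma> \<in> pos_roots \<Delta> B. \<exists>!w. w \<in> F \<and> \<gamma> \<in> inversions \<Delta> B w}"

definition shortest_to ::
    "'v::euclidean_space set \<Rightarrow> 'v set \<Rightarrow> 'v \<Rightarrow> 'v \<Rightarrow> 'v \<Rightarrow> 'v" where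
  "shortest_to \<Delta> B \<gamma> \<alpha> =
     (THE w. w \<in> weyl \<Delta> \<and> w \<gamma> = \<alpha> \<and>
        (\<forall>w'\<in>weyl \<Delta>. w' \<gamma> = \<alpha> \<longrightarrow> weyl_length B w \<le> weyl_length B w'))"

definition w_tilde ::
    "'v::euclidean_space set \<Rightarrow> 'v set \<Rightarrow> 'v \<Rightarrow> 'v \<Rightarrow> 'v \<Rightarrow> 'v" where
  "w_tilde \<Delta> B \<alpha> \<gamma> = refl \<alpha> \<circ> shortest_to \<Delta> B \<gamma> \<alpha>"

section \<open>The affine Weyl group and the simple root attached to an abelian ideal\<close>

text \<open>The pair \<open>(\<nu>, k)\<close> stands for \<open>\<nu> + k\<delta>\<close>. The bilinear form is that of \<open>V\<close>, extended
  by putting \<open>\<delta>\<close> in its radical.\<close>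

definition aff_roots_pos :: "'v::euclidean_space set \<Rightarrow> 'v set \<Rightarrow> ('v \<times> real) set" where
  "aff_roots_pos \<Delta> B =
     {(\<nu>, of_int k) |\<nu> k. \<nu> \<in> \<Delta> \<and> (0 < k \<or> (k = 0 \<and> \<nu> \<in> pos_roots \<Delta> B))}"

definition aff_refl :: "'v::euclidean_space \<times> real \<Rightarrow> 'v \<times> real \<Rightarrow> 'v \<times> real" where
  "aff_refl \<beta> x = x - (2 * (fst x \<bullet> fst \<beta>) / (fst \<beta> \<bullet> fst \<beta>)) *\<^sub>R \<beta>"

definition alpha0 :: "'v::euclidean_space \<Rightarrow> 'v \<times> real" where
  "alpha0 \<theta> = (- \<theta>, 1)"

definition aff_weyl :: "'v::euclidean_space set \<Rightarrow> 'v \<Rightarrow> ('v \<times> real \<Rightarrow> 'v \<times> real) set" where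
  "aff_weyl \<Delta> \<theta> =
     gen_maps (insert (aff_refl (alpha0 \<theta>)) ((\<lambda>w. map_prod w id) ` weyl \<Delta>))"

definition aff_inversions ::
    "'v::euclidean_space set \<Rightarrow> 'v set \<Rightarrow> ('v \<times> real \<Rightarrow> 'v \<times> real) \<Rightarrow> ('v \<times> real) set" where
  "aff_inversions \<Delta> B w = {\<beta> \<in> aff_roots_pos \<Delta> B. w \<beta> \<in> uminus ` aff_roots_pos \<Delta> B}"

definition comb_abelian_ideal :: "'v::euclidean_space set \<Rightarrow> 'v set \<Rightarrow> 'v set \<Rightarrow> bool" where
  "comb_abelian_ideal \<Delta> B I \<longleftrightarrow>
     I \<subseteq> pos_roots \<Delta> B \<and>
     (\<forall>\<gamma>\<in>I. \<forall>\<nu>\<in>pos_roots \<Delta> B. \<gamma> + \<nu> \<in> \<Delta> \<longrightarrow> \<gamma> + \<nu> \<in> I) \<and>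
     (\<forall>\<gamma>\<in>I. \<forall>\<gamma>'\<in>I. \<gamma> + \<gamma>' \<notin> \<Delta>)"

text \<open>The fibre over \<open>\<mu>\<close> of the map \<open>\<tau>\<close>, \<open>\<tau>(I) = w\<^sub>I(\<alpha>\<^sub>0) + \<delta>\<close>, on nonzero abelian ideals.
  The element \<open>w\<^sub>I\<close> of the affine Weyl group is determined by its inversion set.\<close>

definition tau_fibre ::
    "'v::euclidean_space set \<Rightarrow> 'v set \<Rightarrow> 'v \<Rightarrow> 'v \<Rightarrow> 'v set set" where
  "tau_fibre \<Delta> B \<theta> \<mu> =
     {I. comb_abelian_ideal \<Delta> B I \<and> I \<noteq> {} \<and>
         (\<exists>w\<in>aff_weyl \<Delta> \<theta>. aff_inversions \<Delta> B w = {(- \<gamma>, 1) |\<gamma>. \<gamma> \<in> I} \<and>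
            w (alpha0 \<theta>) + (0, 1) = (\<mu>, 0))}"

text \<open>\<open>I = I(\<mu>)\<^sub>m\<^sub>a\<^sub>x\<close>: the unique maximal element of the fibre is \<open>I\<close>.\<close>

definition is_fibre_max ::
    "'v::euclidean_space set \<Rightarrow> 'v set \<Rightarrow> 'v \<Rightarrow> 'v \<Rightarrow> 'v set \<Rightarrow> bool" where
  "is_fibre_max \<Delta> B \<theta> \<mu> I \<longleftrightarrow>
     {J \<in> tau_fibre \<Delta> B \<theta> \<mu>. \<forall>K\<in>tau_fibre \<Delta> B \<theta> \<mu>. J \<subseteq> K \<longrightarrow> K = J} = {I}"

section \<open>Simple complex Lie algebras with a triangular decomposition\<close>

text \<open>A complex vector space is a type \<open>'g\<close> with a scalar multiplication \<open>sc\<close>;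
  the Lie algebra is the whole type.\<close>

locale lie_algebra = vector_space sc
  for sc :: "complex \<Rightarrow> 'g::ab_group_add \<Rightarrow> 'g" +
  fixes br :: "'g \<Rightarrow> 'g \<Rightarrow> 'g"
  assumes br_linear_left: "Vector_Spaces.linear sc sc (\<lambda>x. br x y)"
    and br_linear_right: "Vector_Spaces.linear sc sc (br x)"
    and br_alternating: "br x x = 0"
    and jacobi: "br x (br y z) + br y (br z x) + br z (br x y) = 0"

locale simple_lie_algebra = lie_algebra sc br
  for sc :: "complex \<Rightarrow> 'g::ab_group_add \<Rightarrow> 'g" and br +
  assumes finite_dim: "\<exists>S. finite S \<and> span S = UNIV"
    and not_abelian: "\<exists>x y. br x y \<noteq> 0"
    and no_ideals: "\<And>S. subspace S \<Longrightarrow> (\<And>x y. y \<in> S \<Longrightarrow> br x y \<in> S) \<Longrightarrow> S = {0} \<or> S = UNIV"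

text \<open>The Euclidean space \<open>V\<close> is a real form of the dual of the Cartan subalgebra. The inner
  product identifies it with a real form of the Cartan subalgebra itself, and this
  identification is recorded by a map \<open>H\<close> from \<open>V\<close> to the Lie algebra: the functional
  \<open>\<gamma> \<in> V\<close> takes the value \<open>\<gamma> \<bullet> v\<close> on \<open>H v\<close>.\<close>

definition root_space ::
    "(complex \<Rightarrow> 'g::ab_group_add \<Rightarrow> 'g) \<Rightarrow> ('g \<Rightarrow> 'g \<Rightarrow> 'g) \<Rightarrow> ('v::euclidean_space \<Rightarrow> 'g)
      \<Rightarrow> 'v \<Rightarrow> 'g set" where
  "root_space sc br H \<gamma> = {x. \<forall>v. br (H v) x = sc (complex_of_real (\<gamma> \<bullet> v)) x}"

definition root_sum ::
    "(complex \<Rightarrow> 'g::ab_group_add \<Rightarrow> 'g) \<Rightarrow> ('g \<Rightarrow> 'g \<Rightarrow> 'g) \<Rightarrow> ('v::euclidean_space \<Rightarrow> 'g)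
      \<Rightarrow> 'v set \<Rightarrow> 'g set" where
  "root_sum sc br H S = module.span sc (\<Union>\<gamma>\<in>S. root_space sc br H \<gamma>)"

definition torus ::
    "(complex \<Rightarrow> 'g::ab_group_add \<Rightarrow> 'g) \<Rightarrow> ('v::euclidean_space \<Rightarrow> 'g) \<Rightarrow> 'g set" where
  "torus sc H = module.span sc (range H)"

text \<open>The torus \<open>\<tt>\<close> is abelian, \<open>\<Delta>\<close> is the set of roots with respect to it, and
  the Lie algebra is \<open>\<uu>\<^sup>- + \<tt> + \<uu>\<^sup>+\<close>. The sum is automatically direct, being a sum of
  simultaneous eigenspaces, so \<open>\<tt>\<close> equals its own centralizer and acts diagonalizably: it is
  a Cartan subalgebra. As \<open>\<Delta>\<close> spans \<open>V\<close>, a complex basis of \<open>\<tt>\<close> is the image under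
  \<open>H\<close> of a real basis of \<open>V\<close>.\<close>

definition triangular_decomposition ::
    "(complex \<Rightarrow> 'g::ab_group_add \<Rightarrow> 'g) \<Rightarrow> ('g \<Rightarrow> 'g \<Rightarrow> 'g) \<Rightarrow> ('v::euclidean_space \<Rightarrow> 'g)
      \<Rightarrow> 'v set \<Rightarrow> 'v set \<Rightarrow> bool" where
  "triangular_decomposition sc br H \<Delta> B \<longleftrightarrow>
     (\<forall>u v. H (u + v) = H u + H v) \<and>
     (\<forall>r v. H (r *\<^sub>R v) = sc (complex_of_real r) (H v)) \<and>
     (\<forall>u v. br (H u) (H v) = 0) \<and>
     \<Delta> = {\<gamma>. \<gamma> \<noteq> 0 \<and> root_space sc br H \<gamma> \<noteq> {0}} \<and>
     (\<forall>z. \<exists>x\<in>root_sum sc br H (uminus ` pos_roots \<Delta> B). \<exists>h\<in>torus sc H.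
        \<exists>y\<in>root_sum sc br H (pos_roots \<Delta> B). z = x + h + y)"

definition borel_subalg ::
    "(complex \<Rightarrow> 'g::ab_group_add \<Rightarrow> 'g) \<Rightarrow> ('g \<Rightarrow> 'g \<Rightarrow> 'g) \<Rightarrow> ('v::euclidean_space \<Rightarrow> 'g)
      \<Rightarrow> 'v set \<Rightarrow> 'v set \<Rightarrow> 'g set" where
  "borel_subalg sc br H \<Delta> B =
     {h + y |h y. h \<in> torus sc H \<and> y \<in> root_sum sc br H (pos_roots \<Delta> B)}"

definition abelian_ideal ::
    "(complex \<Rightarrow> 'g::ab_group_add \<Rightarrow> 'g) \<Rightarrow> ('g \<Rightarrow> 'g \<Rightarrow> 'g) \<Rightarrow> 'g set \<Rightarrow> 'g set \<Rightarrow> bool" where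
  "abelian_ideal sc br \<bb> \<aa> \<longleftrightarrow>
     module.subspace sc \<aa> \<and> \<aa> \<subseteq> \<bb> \<and>
     (\<forall>x\<in>\<bb>. \<forall>y\<in>\<aa>. br x y \<in> \<aa>) \<and> (\<forall>x\<in>\<aa>. \<forall>y\<in>\<aa>. br x y = 0)"

definition maximal_abelian_ideal ::
    "(complex \<Rightarrow> 'g::ab_group_add \<Rightarrow> 'g) \<Rightarrow> ('g \<Rightarrow> 'g \<Rightarrow> 'g) \<Rightarrow> 'g set \<Rightarrow> 'g set \<Rightarrow> bool" where
  "maximal_abelian_ideal sc br \<bb> \<aa> \<longleftrightarrow>
     abelian_ideal sc br \<bb> \<aa> \<and>
     (\<forall>\<aa>'. abelian_ideal sc br \<bb> \<aa>' \<and> \<aa> \<subseteq> \<aa>' \<longrightarrow> \<aa>' = \<aa>)"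

definition ideal_roots ::
    "(complex \<Rightarrow> 'g::ab_group_add \<Rightarrow> 'g) \<Rightarrow> ('g \<Rightarrow> 'g \<Rightarrow> 'g) \<Rightarrow> ('v::euclidean_space \<Rightarrow> 'g)
      \<Rightarrow> 'v set \<Rightarrow> 'v set \<Rightarrow> 'g set \<Rightarrow> 'v set" where
  "ideal_roots sc br H \<Delta> B \<aa> = {\<gamma> \<in> pos_roots \<Delta> B. root_space sc br H \<gamma> \<subseteq> \<aa>}"

end

theory Submission
  imports Defs
begin

text \<open>
  Let \<open>w\<^sub>\<gamma>\<close> be the shortest element taking \<open>\<gamma>\<close> to \<open>\<alpha>\<close>. In the simply-laced case it is obtained by
  subtracting simple roots from \<open>\<gamma>\<close> one at a time without ever losing \<open>\<alpha>\<close>, so a step with \<open>\<beta>\<close> gives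
  \<open>w\<^sub>\<gamma> = w\<^bsub>\<gamma> - \<beta>\<^esub> \<circ> \<sigma>\<^sub>\<beta>\<close> (lemma \<open>shortest_step\<close>). If \<open>\<gamma> = \<nu> + \<nu>'\<close> with roots \<open>\<nu>\<close>, \<open>\<nu>'\<close>, then
  \<open>w\<^sub>\<gamma> \<nu> + w\<^sub>\<gamma> \<nu>' = \<alpha>\<close> is simple, so exactly one of the two images is negative. Hence the inversions of
  \<open>\<sigma>\<^sub>\<alpha> w\<^sub>\<gamma>\<close> are \<open>\<gamma>\<close> itself and one half of each decomposition of \<open>\<gamma>\<close> into two positive roots.

  Everything follows from the claim that the inverted half never lies in the ideal \<open>I\<close>
  (\<open>ideal_above_and_positive\<close>): if \<open>\<gamma>, \<nu> \<in> I\<close> and \<open>\<gamma> - \<nu>\<close> is a positive root, then \<open>w\<^sub>\<gamma> \<nu>\<close> is positive.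
  Given the claim, \<open>\<gamma> \<in> I\<close> is inverted by its own element and by no other, which gives the essential
  roots, injectivity and minimality. For completeness, a positive root \<open>\<nu> \<notin> I\<close> satisfies
  \<open>\<nu> + \<nu>' \<in> \<Delta>\<close> for some \<open>\<nu>' \<in> I\<close>: the roots that cannot be added to any root of \<open>I\<close> form an ideal, and
  a highest one outside \<open>I\<close> would enlarge \<open>I\<close> to a bigger abelian ideal (\<open>ideal_self_centralizing\<close>).
  Then \<open>\<gamma> = \<nu> + \<nu>' \<in> I\<close>, the half \<open>\<nu>'\<close> is not inverted by \<open>w\<^sub>\<gamma>\<close>, and so \<open>\<nu>\<close> is.

  The claim is proved from the highest root \<open>\<theta>\<close> downwards. The step from \<open>\<gamma> + \<beta>\<close> to \<open>\<gamma>\<close> is a short case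
  distinction, which also yields \<open>\<gamma> \<succcurlyeq> \<alpha>\<close>: a root \<open>\<nu>\<close> without \<open>\<alpha>\<close> in its support is always the
  inverted half (\<open>shortest_inverts_off_support\<close>), so the claim at \<open>\<gamma> + \<alpha>\<close> excludes it from \<open>I\<close>. The case
  \<open>\<gamma> = \<theta>\<close> is where \<open>\<tau>(I) = \<alpha>\<close> enters. With the affine element \<open>w\<^sub>I\<close> put \<open>u = w\<^sub>I \<circ> \<sigma>\<^sub>0\<close>. Then
  \<open>u \<theta> = \<alpha>\<close>, and the inversions of \<open>u\<close> are the roots \<open>\<theta> - \<nu>\<close> for \<open>\<nu> \<in> I\<close> not orthogonal to \<open>\<theta>\<close>
  and different from \<open>\<theta>\<close>, together with affine roots orthogonal to \<open>\<theta>\<close>. Peeling off the finite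
  inversions with simple reflections produces \<open>w\<^sub>\<theta>\<close>; what remains has only inversions orthogonal to the
  current root and therefore fixes it (\<open>fixes_orthogonal_to_inversions\<close>,
  \<open>affine_to_finite_inversions\<close>). So \<open>u\<close> and \<open>w\<^sub>\<theta>\<close> have the same finite inversions.

  On the Lie algebra side one needs that a maximal abelian ideal is the sum of the root spaces of a
  combinatorial abelian ideal that cannot be enlarged, and that root spaces are lines. The latter
  follows once every root lies in an \<open>sl\<^sub>2\<close>-triple; the root spaces violating this span an ideal,
  which vanishes because the Lie algebra is simple (\<open>all_roots_sl2\<close>).
\<close>

section \<open>Simply-laced root systems\<close>

locale ade_root_system =
  fixes \<Delta> B :: "'v::euclidean_space set" and \<theta> :: 'v
  assumes roots: "root_system \<Delta>"
    and simple: "simple_roots \<Delta> B"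
    and highest: "highest_root \<Delta> B \<theta>"
    and laced: "simply_laced \<Delta>"
begin

abbreviation P :: "'v set" where "P \<equiv> pos_roots \<Delta> B"

definition coef :: "'v \<Rightarrow> 'v \<Rightarrow> real" where
  "coef b x = representation B x b"

definition height :: "'v \<Rightarrow> real" where
  "height x = (\<Sum>b\<in>B. coef b x)"

text \<open>Rescaled so that roots have square length 2; on roots it is the (now symmetric) Cartan integer.\<close>
definition pair :: "'v \<Rightarrow> 'v \<Rightarrow> real" where
  "pair x y = 2 * (x \<bullet> y) / (\<theta> \<bullet> \<theta>)"

lemma finite_roots: "finite \<Delta>"
  using roots by (simp add: root_system_def)

lemma simple_sub: "B \<subseteq> \<Delta>"
  and independent_simple: "independent B"
  using simple by (auto simp: simple_roots_def)

lemma simple_root: "b \<in> B \<Longrightarrow> b \<in> \<Delta>"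
  using simple_sub by blast

lemma finite_simple: "finite B"
  using finite_roots simple_sub finite_subset by blast

lemma root_in_span: "x \<in> \<Delta> \<Longrightarrow> x \<in> span B"
proof -
  assume x: "x \<in> \<Delta>"
  have "\<exists>c :: 'v \<Rightarrow> nat. x = (\<Sum>\<beta>\<in>B. real (c \<beta>) *\<^sub>R \<beta>) \<or> - x = (\<Sum>\<beta>\<in>B. real (c \<beta>) *\<^sub>R \<beta>)"
    using simple x unfolding simple_roots_def root_ge_def by fastforce
  moreover have "(\<Sum>\<beta>\<in>B. real (c \<beta>) *\<^sub>R \<beta>) \<in> span B" for c :: "'v \<Rightarrow> nat"
    by (intro span_sum span_scale span_base)
  ultimately have "x \<in> span B \<or> - x \<in> span B"
    by metis
  then show ?thesis
    using span_neg[of "- x" B] by auto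
qed

lemma span_simple: "span B = UNIV"
proof -
  have "span \<Delta> \<subseteq> span B"
    using root_in_span by (simp add: span_minimal subsetI)
  thus ?thesis
    using roots by (auto simp: root_system_def)
qed

lemma in_span_simple [simp]: "x \<in> span B"
  by (simp add: span_simple)

lemma coef_add [simp]: "coef b (x + y) = coef b x + coef b y"
  and coef_diff [simp]: "coef b (x - y) = coef b x - coef b y"
  and coef_minus [simp]: "coef b (- x) = - coef b x"
  and coef_scale [simp]: "coef b (c *\<^sub>R x) = c * coef b x"
  and coef_zero [simp]: "coef b 0 = 0"
  unfolding coef_def
  by (simp_all add: representation_add representation_diff representation_neg
      representation_scale representation_zero independent_simple)

lemma coef_simple: "b' \<in> B \<Longrightarrow> coef b b' = (if b = b' then 1 else 0)"
  unfolding coef_def by (simp add: representation_basis independent_simple)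

lemma coef_sum: "coef b (\<Sum>i\<in>A. g i) = (\<Sum>i\<in>A. coef b (g i))"
  by (induction A rule: infinite_finite_induct) auto

lemma coef_expand: "(\<Sum>b\<in>B. coef b x *\<^sub>R b) = x"
  unfolding coef_def
  using sum_representation_eq[OF independent_simple, of x B] finite_simple by simp

lemma orthogonal_to_simple: "(\<And>b. b \<in> B \<Longrightarrow> b \<bullet> u = 0) \<Longrightarrow> u = 0"
proof -
  assume *: "\<And>b. b \<in> B \<Longrightarrow> b \<bullet> u = 0"
  have "(\<Sum>b\<in>A. coef b u *\<^sub>R b) \<bullet> u = 0" if "A \<subseteq> B" for A
    using that * by (induction A rule: infinite_finite_induct) (auto simp: inner_add_left)
  then show ?thesis using coef_expand[of u] by force
qed

text \<open>Coordinates with respect to the simple roots turn the order into coordinatewise conditions, on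
which the rest of the argument computes.\<close>
lemma root_ge_iff: "root_ge B x y \<longleftrightarrow> (\<forall>b\<in>B. coef b (x - y) \<in> \<nat>)"
proof
  assume "root_ge B x y"
  then obtain c :: "'v \<Rightarrow> nat" where c: "x - y = (\<Sum>\<beta>\<in>B. real (c \<beta>) *\<^sub>R \<beta>)"
    by (auto simp: root_ge_def)
  show "\<forall>b\<in>B. coef b (x - y) \<in> \<nat>"
  proof
    fix b assume b: "b \<in> B"
    have "coef b (x - y) = (\<Sum>\<beta>\<in>B. real (c \<beta>) * coef b \<beta>)"
      unfolding c coef_sum by simp
    also have "\<dots> = (\<Sum>\<beta>\<in>B. if b = \<beta> then real (c \<beta>) else 0)"
      by (intro sum.cong) (auto simp: coef_simple)
    also have "\<dots> = real (c b)"
      using b finite_simple by simp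
    finally show "coef b (x - y) \<in> \<nat>" by simp
  qed
next
  assume *: "\<forall>b\<in>B. coef b (x - y) \<in> \<nat>"
  then have "\<forall>b\<in>B. \<exists>n. coef b (x - y) = real n"
    by (auto elim: Nats_cases)
  then obtain c where c: "\<forall>b\<in>B. coef b (x - y) = real (c b)"
    by metis
  have "x - y = (\<Sum>b\<in>B. coef b (x - y) *\<^sub>R b)"
    by (simp only: coef_expand)
  also have "\<dots> = (\<Sum>b\<in>B. real (c b) *\<^sub>R b)"
    using c by (intro sum.cong) auto
  finally show "root_ge B x y"
    by (auto simp: root_ge_def)
qed

lemma zero_not_root: "0 \<notin> \<Delta>"
  using roots by (simp add: root_system_def)

lemma coef_eqI: "(\<And>b. b \<in> B \<Longrightarrow> coef b x = coef b y) \<Longrightarrow> x = y"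
  using coef_expand[of x] coef_expand[of y] by (metis (no_types, lifting) sum.cong)

lemma root_signs: "x \<in> \<Delta> \<Longrightarrow> (\<forall>b\<in>B. coef b x \<in> \<nat>) \<or> (\<forall>b\<in>B. - coef b x \<in> \<nat>)"
  using simple unfolding simple_roots_def root_ge_iff by fastforce

lemma pos_iff: "x \<in> P \<longleftrightarrow> x \<in> \<Delta> \<and> (\<forall>b\<in>B. 0 \<le> coef b x)"
proof
  assume "x \<in> P"
  then show "x \<in> \<Delta> \<and> (\<forall>b\<in>B. 0 \<le> coef b x)"
    unfolding pos_roots_def root_ge_iff by (auto simp: Nats_altdef2)
next
  assume *: "x \<in> \<Delta> \<and> (\<forall>b\<in>B. 0 \<le> coef b x)"
  have "coef b x \<in> \<nat>" if "b \<in> B" for b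
  proof -
    have "0 \<le> coef b x" using * that by blast
    moreover have "coef b x \<in> \<nat> \<or> - coef b x \<in> \<nat>" using root_signs[of x] * that by blast
    ultimately show ?thesis
      by (metis Nats_cases Nats_0 neg_0_le_iff_le of_nat_0_le_iff order_antisym)
  qed
  then show "x \<in> P"
    using * unfolding pos_roots_def root_ge_iff by auto
qed

lemma pos_root: "x \<in> P \<Longrightarrow> x \<in> \<Delta>"
  by (simp add: pos_iff)

lemma coef_nonneg: "x \<in> P \<Longrightarrow> b \<in> B \<Longrightarrow> 0 \<le> coef b x"
  by (simp add: pos_iff)

lemma finite_pos: "finite P"
  using finite_roots by (simp add: pos_roots_def)

lemma coef_nat: "x \<in> P \<Longrightarrow> b \<in> B \<Longrightarrow> coef b x \<in> \<nat>"
  unfolding pos_roots_def root_ge_iff by auto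

lemma refl_in_roots: "x \<in> \<Delta> \<Longrightarrow> y \<in> \<Delta> \<Longrightarrow> refl x y \<in> \<Delta>"
proof -
  assume "x \<in> \<Delta>" "y \<in> \<Delta>"
  moreover have "\<forall>\<gamma>\<in>\<Delta>. refl \<gamma> ` \<Delta> \<subseteq> \<Delta>"
    using roots by (simp add: root_system_def)
  ultimately show ?thesis by (meson image_eqI subsetD)
qed

lemma neg_root: "x \<in> \<Delta> \<Longrightarrow> - x \<in> \<Delta>"
proof -
  assume x: "x \<in> \<Delta>"
  have "refl x x \<in> \<Delta>"
    using refl_in_roots x by blast
  moreover have "refl x x = - x"
    using x zero_not_root by (auto simp: refl_def scaleR_2)
  ultimately show ?thesis by simp
qed

lemma pos_or_neg: "x \<in> \<Delta> \<Longrightarrow> x \<in> P \<or> - x \<in> P"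
proof -
  assume x: "x \<in> \<Delta>"
  have "c \<in> \<nat> \<Longrightarrow> 0 \<le> c" for c :: real by (auto elim: Nats_cases)
  then have "(\<forall>b\<in>B. 0 \<le> coef b x) \<or> (\<forall>b\<in>B. 0 \<le> coef b (- x))"
    using root_signs[OF x] by (metis coef_minus)
  then show ?thesis using x neg_root[OF x] by (auto simp only: pos_iff)
qed

lemma not_pos_and_neg: "x \<in> P \<Longrightarrow> - x \<notin> P"
proof
  assume "x \<in> P" "- x \<in> P"
  then have "coef b x = 0" if "b \<in> B" for b
    using that unfolding pos_iff coef_minus by (meson neg_0_le_iff_le order_antisym)
  then have "x = 0" by (intro coef_eqI) simp
  then show False using \<open>x \<in> P\<close> zero_not_root unfolding pos_iff by simp
qed

lemma simple_pos: "b \<in> B \<Longrightarrow> b \<in> P"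
  unfolding pos_iff by (auto simp: coef_simple simple_root)

lemma pos_add: "x \<in> P \<Longrightarrow> y \<in> P \<Longrightarrow> x + y \<in> \<Delta> \<Longrightarrow> x + y \<in> P"
  unfolding pos_iff by auto

lemma pos_add_ne_zero: "x \<in> P \<Longrightarrow> y \<in> P \<Longrightarrow> x + y \<noteq> 0"
  using not_pos_and_neg by (metis add.commute add_eq_0_iff)

lemma coef_pos_ge_1: "x \<in> P \<Longrightarrow> b \<in> B \<Longrightarrow> 0 < coef b x \<Longrightarrow> 1 \<le> coef b x"
  using coef_nat[of x b] by (auto elim!: Nats_cases)

lemma theta_root: "\<theta> \<in> \<Delta>"
  using highest by (simp add: highest_root_def)

lemma root_norm: "x \<in> \<Delta> \<Longrightarrow> x \<bullet> x = \<theta> \<bullet> \<theta>"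
  using laced theta_root unfolding simply_laced_def by (metis dot_square_norm)

lemma theta_norm_pos: "\<theta> \<bullet> \<theta> > 0"
  using theta_root zero_not_root by auto

lemma pair_add_left [simp]: "pair (x + y) z = pair x z + pair y z"
  and pair_add_right [simp]: "pair z (x + y) = pair z x + pair z y"
  and pair_diff_left [simp]: "pair (x - y) z = pair x z - pair y z"
  and pair_diff_right [simp]: "pair z (x - y) = pair z x - pair z y"
  and pair_minus_left [simp]: "pair (- x) z = - pair x z"
  and pair_minus_right [simp]: "pair z (- x) = - pair z x"
  and pair_scale_left [simp]: "pair (c *\<^sub>R x) z = c * pair x z"
  and pair_scale_right [simp]: "pair z (c *\<^sub>R x) = c * pair z x"
  and pair_zero [simp]: "pair 0 z = 0" "pair z 0 = 0"
  unfolding pair_def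
  by (auto simp: inner_add_left inner_add_right inner_diff_left inner_diff_right algebra_simps
     add_divide_distrib diff_divide_distrib)

lemma pair_commute: "pair x y = pair y x"
  by (simp add: pair_def inner_commute)

lemma pair_self [simp]: "x \<in> \<Delta> \<Longrightarrow> pair x x = 2"
  using theta_norm_pos by (simp add: pair_def root_norm)

lemma refl_root: "x \<in> \<Delta> \<Longrightarrow> refl x y = y - pair y x *\<^sub>R x"
  by (simp add: refl_def pair_def root_norm)

lemma pair_int: "x \<in> \<Delta> \<Longrightarrow> y \<in> \<Delta> \<Longrightarrow> pair x y \<in> \<int>"
proof -
  assume "x \<in> \<Delta>" "y \<in> \<Delta>"
  moreover have "\<forall>\<gamma>\<in>\<Delta>. \<forall>\<nu>\<in>\<Delta>. 2 * (\<nu> \<bullet> \<gamma>) / (\<gamma> \<bullet> \<gamma>) \<in> \<int>"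
    using roots by (simp add: root_system_def)
  ultimately have "2 * (x \<bullet> y) / (y \<bullet> y) \<in> \<int>" by simp
  then show ?thesis using \<open>y \<in> \<Delta>\<close> by (simp add: pair_def root_norm)
qed

lemma pair_diff_self: "x \<in> \<Delta> \<Longrightarrow> y \<in> \<Delta> \<Longrightarrow> pair (x - y) (x - y) = 4 - 2 * pair x y"
  by (simp add: pair_commute[of y x])

lemma pair_nonneg: "pair x x \<ge> 0"
  using theta_norm_pos by (simp add: pair_def)

lemma pair_self_eq_0: "pair x x = 0 \<longleftrightarrow> x = 0"
  using theta_norm_pos by (auto simp: pair_def)

lemma pair_le: "x \<in> \<Delta> \<Longrightarrow> y \<in> \<Delta> \<Longrightarrow> pair x y \<le> 2"
  using pair_nonneg[of "x - y"] pair_diff_self by fastforce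

lemma pair_eq_2: "x \<in> \<Delta> \<Longrightarrow> y \<in> \<Delta> \<Longrightarrow> pair x y = 2 \<longleftrightarrow> x = y"
  using pair_self_eq_0[of "x - y"] pair_diff_self by fastforce

lemma pair_ge: "x \<in> \<Delta> \<Longrightarrow> y \<in> \<Delta> \<Longrightarrow> - 2 \<le> pair x y"
  using pair_le[of "- x" y] neg_root by simp

lemma pair_eq_minus_2: "x \<in> \<Delta> \<Longrightarrow> y \<in> \<Delta> \<Longrightarrow> pair x y = - 2 \<longleftrightarrow> x = - y"
  using pair_eq_2[of "- x" y] neg_root by (auto simp: minus_equation_iff)

text \<open>Cauchy--Schwarz leaves five integers, with the extreme ones attained only for equal or opposite
roots.\<close>
lemma pair_cases:
  assumes "x \<in> \<Delta>" "y \<in> \<Delta>"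
  obtains "x = y" "pair x y = 2" | "pair x y = 1" | "pair x y = 0" | "pair x y = - 1"
    | "x = - y" "pair x y = - 2"
proof -
  obtain n where n: "pair x y = of_int n"
    using pair_int[OF assms] by (auto elim: Ints_cases)
  have "n \<le> 2" "- 2 \<le> n"
    using pair_le[OF assms] pair_ge[OF assms] n by linarith+
  then have "n = 2 \<or> n = 1 \<or> n = 0 \<or> n = - 1 \<or> n = - 2" by auto
  then show thesis
    using that n pair_eq_2[OF assms] pair_eq_minus_2[OF assms] by fastforce
qed

lemma add_root_iff:
  assumes "x \<in> \<Delta>" "y \<in> \<Delta>" shows "x + y \<in> \<Delta> \<longleftrightarrow> pair x y = - 1"
proof
  assume "x + y \<in> \<Delta>"
  then show "pair x y = - 1"
    using pair_self[of "x + y"] assms by (simp add: pair_commute[of y x])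
next
  assume "pair x y = - 1"
  then show "x + y \<in> \<Delta>"
    using refl_in_roots[of y x] assms by (simp add: refl_root)
qed

lemma diff_root_iff:
  assumes "x \<in> \<Delta>" "y \<in> \<Delta>" shows "x - y \<in> \<Delta> \<longleftrightarrow> pair x y = 1"
  using add_root_iff[of x "- y"] assms neg_root by simp

lemma pair_lt_0: "x \<in> \<Delta> \<Longrightarrow> y \<in> \<Delta> \<Longrightarrow> pair x y < 0 \<Longrightarrow> x = - y \<or> pair x y = - 1"
  by (cases rule: pair_cases[of x y]) auto

lemma pair_gt_0: "x \<in> \<Delta> \<Longrightarrow> y \<in> \<Delta> \<Longrightarrow> 0 < pair x y \<Longrightarrow> x = y \<or> pair x y = 1"
  by (cases rule: pair_cases[of x y]) auto

lemma refl_refl [simp]: "x \<in> \<Delta> \<Longrightarrow> refl x (refl x y) = y"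
  by (simp add: refl_root)

lemma refl_self [simp]: "x \<in> \<Delta> \<Longrightarrow> refl x x = - x"
  by (simp add: refl_root scaleR_2)

lemma pair_refl: "x \<in> \<Delta> \<Longrightarrow> pair (refl x y) (refl x z) = pair y z"
  by (simp add: refl_root algebra_simps pair_commute[of x z])

text \<open>A positive root other than the simple root has another simple root in its support, whose
coefficient the reflection leaves unchanged and positive.\<close>
lemma simple_refl_pos:
  assumes "b \<in> B" "x \<in> P" "x \<noteq> b" shows "refl b x \<in> P"
proof -
  have xr: "x \<in> \<Delta>" and br: "b \<in> \<Delta>"
    using assms pos_root simple_root by auto
  have "\<exists>c\<in>B. c \<noteq> b \<and> 0 < coef c x"
  proof (rule ccontr)
    assume "\<not> ?thesis"
    then have *: "\<forall>c\<in>B. c \<noteq> b \<longrightarrow> coef c x = 0"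
      using assms(2) by (meson linorder_not_less order_antisym_conv pos_iff)
    have "x = coef b x *\<^sub>R b"
      by (rule coef_eqI) (use * assms(1) in \<open>auto simp: coef_simple\<close>)
    moreover have "coef b x = 1 \<or> coef b x = - 1"
    proof -
      have "\<forall>\<gamma>\<in>\<Delta>. \<forall>c::real. c *\<^sub>R \<gamma> \<in> \<Delta> \<longrightarrow> c = 1 \<or> c = -1"
        using roots by (simp add: root_system_def)
      then show ?thesis using xr br calculation by metis
    qed
    ultimately show False
      using assms by (metis not_pos_and_neg scaleR_minus1_left scaleR_one simple_pos)
  qed
  then obtain c where c: "c \<in> B" "c \<noteq> b" "0 < coef c x" by blast
  have r: "refl b x \<in> \<Delta>" using refl_in_roots xr br by blast
  have "coef c (refl b x) = coef c x"
    using c assms(1) br by (simp add: refl_root coef_simple)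
  then have "- refl b x \<notin> P"
    using c pos_iff by fastforce
  then show ?thesis using pos_or_neg[OF r] by blast
qed

lemma simple_sub_pos:
  assumes "b \<in> B" "x \<in> P" "pair x b = 1"
  shows "x - b \<in> P"
proof -
  have "x \<noteq> b" using assms simple_root by force
  then show ?thesis
    using simple_refl_pos[OF assms(1,2)] assms by (simp add: refl_root simple_root)
qed

lemma theta_ge: "x \<in> \<Delta> \<Longrightarrow> b \<in> B \<Longrightarrow> coef b x \<le> coef b \<theta>"
  using highest unfolding highest_root_def root_ge_iff by (force simp: Nats_altdef2)

lemma theta_pos: "\<theta> \<in> P"
  using theta_ge[of "- \<theta>"] theta_root neg_root by (force simp: pos_iff)

lemma theta_simple_nonneg: "b \<in> B \<Longrightarrow> 0 \<le> pair \<theta> b"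
proof (rule ccontr)
  assume b: "b \<in> B" and "\<not> 0 \<le> pair \<theta> b"
  then consider "\<theta> = - b" | "pair \<theta> b = - 1"
    using pair_lt_0 theta_root simple_root by fastforce
  then show False
  proof cases
    case 1 then show ?thesis
      using b by (metis not_pos_and_neg simple_pos theta_pos)
  next
    case 2
    then have "\<theta> + b \<in> \<Delta>" using add_root_iff b simple_root theta_root by blast
    then show ?thesis using theta_ge[of "\<theta> + b" b] b by (simp add: coef_simple)
  qed
qed

lemma pair_expand: "pair x y = (\<Sum>b\<in>B. coef b x * pair b y)"
proof -
  have "pair (\<Sum>b\<in>A. coef b x *\<^sub>R b) y = (\<Sum>b\<in>A. coef b x * pair b y)" for A
    by (induction A rule: infinite_finite_induct) auto
  then show ?thesis using coef_expand[of x] by metis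
qed

lemma pair_nonnegI:
  assumes "\<And>b. b \<in> B \<Longrightarrow> 0 \<le> coef b x" "\<And>b. b \<in> B \<Longrightarrow> 0 \<le> pair b y"
  shows "0 \<le> pair x y"
  unfolding pair_expand[of x] using assms by (intro sum_nonneg) simp

lemma theta_pair_nonneg: "x \<in> P \<Longrightarrow> 0 \<le> pair x \<theta>"
  by (rule pair_nonnegI) (auto simp: pos_iff theta_simple_nonneg pair_commute[of _ \<theta>])

text \<open>As \<open>\<theta> - x\<close> is a nonnegative combination of simple roots, dominance of \<open>x\<close> gives
\<open>pair \<theta> x \<ge> pair x x = 2\<close>.\<close>
lemma dominant_is_theta:
  assumes "x \<in> P" "\<And>b. b \<in> B \<Longrightarrow> 0 \<le> pair b x" shows "x = \<theta>"
proof -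
  have "0 \<le> pair (\<theta> - x) x"
    by (rule pair_nonnegI) (use assms theta_ge pos_root in auto)
  then have "2 \<le> pair \<theta> x" using assms pos_root by simp
  then show ?thesis
    using pair_eq_2[of \<theta> x] pair_le[of \<theta> x] assms pos_root theta_root by force
qed

lemma non_theta_ascends:
  assumes "x \<in> P" "x \<noteq> \<theta>"
  obtains b where "b \<in> B" "pair x b = - 1" "x + b \<in> P"
proof -
  obtain b where b: "b \<in> B" "pair x b < 0"
    using dominant_is_theta assms by (metis linorder_not_less pair_commute)
  have "x \<noteq> - b" using b assms by (metis not_pos_and_neg simple_pos)
  then have "pair x b = - 1"
    using pair_lt_0 b assms pos_root simple_root by blast
  then show thesis
    using that b add_root_iff pos_add assms pos_root simple_root simple_pos by metis
qed

lemma height_add [simp]: "height (x + y) = height x + height y"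
  and height_diff [simp]: "height (x - y) = height x - height y"
  and height_minus [simp]: "height (- x) = - height x"
  and height_scale [simp]: "height (c *\<^sub>R x) = c * height x"
  unfolding height_def by (simp_all add: sum.distrib sum_subtractf sum_negf sum_distrib_left)

lemma height_simple [simp]: "b \<in> B \<Longrightarrow> height b = 1"
  unfolding height_def using finite_simple by (simp add: coef_simple)

lemma height_nat: "x \<in> P \<Longrightarrow> height x \<in> \<nat>"
proof -
  assume x: "x \<in> P"
  have "(\<Sum>b\<in>A. coef b x) \<in> \<nat>" if "A \<subseteq> B" for A
    using finite_subset[OF that finite_simple] that
    by (induction A rule: finite_induct) (simp_all add: coef_nat[OF x])
  then show ?thesis unfolding height_def by simp
qed

lemma height_pos: "x \<in> P \<Longrightarrow> 1 \<le> height x"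
proof -
  assume x: "x \<in> P"
  have ex: "\<exists>b\<in>B. coef b x \<noteq> 0"
    using coef_eqI[of x 0] x zero_not_root pos_root by auto
  then have "height x > 0"
  proof -
    obtain b where b: "b \<in> B" "coef b x \<noteq> 0" using ex by blast
    have nn: "\<And>c. c \<in> B \<Longrightarrow> 0 \<le> coef c x" using x by (simp add: pos_iff)
    show ?thesis
      unfolding height_def
      by (rule sum_pos2[OF finite_simple b(1)]) (use b nn in \<open>auto simp: order_less_le\<close>)
  qed
  then show ?thesis using height_nat[OF x] by (auto elim!: Nats_cases)
qed

lemma nonsimple_descends:
  assumes "x \<in> P" "x \<notin> B"
  obtains b where "b \<in> B" "pair x b = 1" "x - b \<in> P"
proof -
  have "\<exists>b\<in>B. 0 < pair b x"
  proof (rule ccontr)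
    assume "\<not> ?thesis"
    then have np: "\<And>b. b \<in> B \<Longrightarrow> pair b x \<le> 0" by (auto simp: not_less)
    have "0 \<le> pair x (- x)"
      by (rule pair_nonnegI) (use np coef_nonneg[OF assms(1)] in \<open>simp_all add: not_less\<close>)
    then show False using pair_self[OF pos_root[OF assms(1)]] by simp
  qed
  then obtain b where b: "b \<in> B" "0 < pair b x" by blast
  moreover have "pair x b = 1"
    using pair_gt_0[OF simple_root[OF b(1)] pos_root[OF assms(1)] b(2)] b(1) assms(2)
    by (auto simp: pair_commute)
  ultimately show thesis using that simple_sub_pos assms(1) by blast
qed

text \<open>Any nonsimple positive root has positive pairing with some simple root, because its pairing with
itself is positive; subtracting that simple root descends within the positive roots.\<close>
lemma pos_induct [consumes 1, case_names simple step]: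
  assumes x: "x \<in> P" and "\<And>b. b \<in> B \<Longrightarrow> Q b"
    and step: "\<And>x b. x \<in> P \<Longrightarrow> b \<in> B \<Longrightarrow> pair x b = - 1 \<Longrightarrow> x + b \<in> P \<Longrightarrow> Q x \<Longrightarrow> Q (x + b)"
  shows "Q x"
  using x
proof (induction "nat \<lfloor>height x\<rfloor>" arbitrary: x rule: less_induct)
  case less
  show ?case
  proof (cases "x \<in> B")
    case True then show ?thesis using assms by blast
  next
    case False
    then obtain b where b: "b \<in> B" "pair x b = 1" "x - b \<in> P"
      using nonsimple_descends less.prems by blast
    have "nat \<lfloor>height (x - b)\<rfloor> < nat \<lfloor>height x\<rfloor>"
      using height_pos[OF b(3)] b by (simp; linarith)
    then have "Q (x - b)" using less b by blast
    then show ?thesis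
      using step[of "x - b" b] b less.prems simple_root by simp
  qed
qed

end

section \<open>Words in simple reflections\<close>

context ade_root_system begin

definition word :: "'v list \<Rightarrow> 'v \<Rightarrow> 'v" where
  "word bs = foldr (\<circ>) (map refl bs) id"

lemma word_simps [simp]: "word [] = id" "word (b # bs) = refl b \<circ> word bs"
  by (simp_all add: word_def)

lemma word_append: "word (as @ bs) = word as \<circ> word bs"
  by (induction as) (simp_all add: comp_assoc)

lemma refl_add: "refl x (y + z) = refl x y + refl x z"
  and refl_minus: "refl x (- y) = - refl x y"
  by (simp_all add: refl_def inner_add_left add_divide_distrib algebra_simps)

lemma refl_diff: "refl x (y - z) = refl x y - refl x z"
  using refl_add[of x y "- z"] by (simp add: refl_minus)

lemma refl_uminus: "refl (- x) = refl x"
  by (simp add: fun_eq_iff refl_def)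

lemma refl_conj:
  assumes "x \<in> \<Delta>" "y \<in> \<Delta>"
  shows "refl (refl x y) = refl x \<circ> refl y \<circ> refl x"
proof
  fix z
  have "refl x y \<in> \<Delta>" using assms refl_in_roots by blast
  then have "refl (refl x y) z = z - pair z (refl x y) *\<^sub>R refl x y"
    by (rule refl_root)
  also have "pair z (refl x y) = pair (refl x z) y"
    using pair_refl[OF assms(1), of "refl x z" y] assms by simp
  also have "z - pair (refl x z) y *\<^sub>R refl x y = refl x (refl x z - pair (refl x z) y *\<^sub>R y)"
    using assms(1) by (simp add: refl_root algebra_simps)
  finally show "refl (refl x y) z = (refl x \<circ> refl y \<circ> refl x) z"
    using assms by (simp add: refl_root)
qed

text \<open>Raising a root by a simple root \<open>b\<close> is applying \<open>refl b\<close>, which conjugates the reflection.\<close>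
lemma refl_simple_word: "x \<in> P \<Longrightarrow> \<exists>bs. set bs \<subseteq> B \<and> refl x = word bs"
proof (induction rule: pos_induct)
  case (simple b)
  then show ?case by (intro exI[of _ "[b]"]) simp
next
  case (step x b)
  then obtain bs where bs: "set bs \<subseteq> B" "refl x = word bs" by blast
  have "x + b = refl b x"
    using step by (simp add: refl_root simple_root)
  then have "refl (x + b) = refl b \<circ> refl x \<circ> refl b"
    using refl_conj[of b x] step simple_root pos_root by simp
  then have "refl (x + b) = word (b # bs @ [b])"
    using bs by (simp add: word_append comp_assoc)
  then show ?case using bs step by (intro exI[of _ "b # bs @ [b]"]) simp
qed

lemma weyl_is_word: "w \<in> weyl \<Delta> \<Longrightarrow> \<exists>bs. set bs \<subseteq> B \<and> w = word bs"
  unfolding weyl_def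
proof (induction rule: gen_maps.induct)
  case gen_id
  then show ?case by (intro exI[of _ "[]"]) simp
next
  case (gen_step s w)
  then obtain x where x: "x \<in> \<Delta>" "s = refl x" by blast
  obtain as where as: "set as \<subseteq> B" "s = word as"
    using refl_simple_word[of x] refl_simple_word[of "- x"] pos_or_neg[OF x(1)] x(2)
    by (metis refl_uminus)
  obtain bs where bs: "set bs \<subseteq> B" "w = word bs" using gen_step by blast
  show ?case using as bs by (intro exI[of _ "as @ bs"]) (simp add: word_append)
qed

lemma word_in_weyl: "set bs \<subseteq> B \<Longrightarrow> word bs \<in> weyl \<Delta>"
  unfolding weyl_def
  by (induction bs) (auto intro: gen_maps.intros simp: simple_root)

lemma weyl_add: "w \<in> weyl \<Delta> \<Longrightarrow> w (x + y) = w x + w y"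
  unfolding weyl_def by (induction rule: gen_maps.induct) (auto simp: refl_add)

lemma weyl_minus: "w \<in> weyl \<Delta> \<Longrightarrow> w (- x) = - w x"
  unfolding weyl_def by (induction rule: gen_maps.induct) (auto simp: refl_minus)

lemma weyl_root: "w \<in> weyl \<Delta> \<Longrightarrow> x \<in> \<Delta> \<Longrightarrow> w x \<in> \<Delta>"
  unfolding weyl_def by (induction rule: gen_maps.induct) (auto simp: refl_in_roots)

text \<open>Heights of roots skip the value 0. Lowering positive heights by one closes this gap, so that even
\<open>b \<mapsto> - b\<close> changes the depth by only one.\<close>
definition depth :: "'v \<Rightarrow> real" where
  "depth x = (if x \<in> P then height x - 1 else height x)"

lemma depth_refl:
  assumes "b \<in> B" "x \<in> \<Delta>" shows "depth x - depth (refl b x) \<le> 1"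
proof -
  have b: "b \<in> P" "b \<in> \<Delta>" "- b \<notin> P" using assms simple_pos simple_root not_pos_and_neg by auto
  have height: "height (refl b x) = height x - pair x b"
    using assms b by (simp add: refl_root)
  consider "x = b" | "x = - b" | "x \<noteq> b" "x \<noteq> - b" by blast
  then show ?thesis
  proof cases
    case 1 then show ?thesis using b assms by (simp add: depth_def)
  next
    case 2 then show ?thesis using b assms by (simp add: depth_def refl_minus)
  next
    case 3
    have p: "pair x b \<le> 1"
      using 3 by (cases rule: pair_cases[OF assms(2) b(2)]) auto
    have "refl b x \<in> P \<longleftrightarrow> x \<in> P"
    proof
      assume "x \<in> P" then show "refl b x \<in> P" using simple_refl_pos 3 assms by blast
    next
      assume *: "refl b x \<in> P"
      have "refl b x \<noteq> b"
        using 3 b by (metis refl_refl refl_self)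
      then have "refl b (refl b x) \<in> P" using simple_refl_pos * assms by blast
      then show "x \<in> P" using b by simp
    qed
    then show ?thesis using p height by (simp add: depth_def)
  qed
qed

text \<open>This bounds the length of a Weyl group element from below by the drop in depth of a single root.\<close>
lemma depth_word:
  assumes "set bs \<subseteq> B" "x \<in> \<Delta>"
  shows "depth x - depth (word bs x) \<le> real (length bs)"
  using assms(1)
proof (induction bs)
  case (Cons b bs)
  have "word bs x \<in> \<Delta>"
    using word_in_weyl weyl_root assms(2) Cons.prems by simp
  then show ?case using depth_refl[of b "word bs x"] Cons by simp
qed simp

lemma weyl_length_word:
  assumes "w \<in> weyl \<Delta>"
  obtains bs where "set bs \<subseteq> B" "length bs = weyl_length B w" "w = word bs"
proof -
  have "\<exists>n bs. set bs \<subseteq> B \<and> length bs = n \<and> w = word bs"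
    using weyl_is_word[OF assms] by blast
  then have "\<exists>bs. set bs \<subseteq> B \<and> length bs = weyl_length B w \<and> w = word bs"
    unfolding weyl_length_def word_def by (rule LeastI_ex)
  then show thesis using that by blast
qed

lemma weyl_length_le: "set bs \<subseteq> B \<Longrightarrow> weyl_length B (word bs) \<le> length bs"
  unfolding weyl_length_def word_def by (rule Least_le) blast

end

section \<open>Shortest elements taking a root to a simple root\<close>

locale ade_simple_root = ade_root_system \<Delta> B \<theta>
  for \<Delta> B :: "'v::euclidean_space set" and \<theta> :: 'v +
  fixes \<alpha> :: 'v
  assumes alpha: "\<alpha> \<in> B"
begin

definition above :: "'v set" where
  "above = {x \<in> P. 1 \<le> coef \<alpha> x}"

lemma above_pos: "x \<in> above \<Longrightarrow> x \<in> P" and above_root: "x \<in> above \<Longrightarrow> x \<in> \<Delta>"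
  by (auto simp: above_def pos_root)

lemma alpha_above: "\<alpha> \<in> above"
  using alpha simple_pos by (simp add: above_def coef_simple)

lemma alpha_root: "\<alpha> \<in> \<Delta>"
  using alpha simple_root by blast

lemma above_simple: "x \<in> above \<Longrightarrow> x \<in> B \<Longrightarrow> x = \<alpha>"
  by (auto simp: above_def coef_simple split: if_splits)

lemma above_add: "x - b \<in> above \<Longrightarrow> x \<in> P \<Longrightarrow> b \<in> B \<Longrightarrow> x \<in> above"
  by (auto simp: above_def coef_simple split: if_splits)

text \<open>Since \<open>\<alpha>\<close> has depth 0, no word taking a positive root \<open>x\<close> to \<open>\<alpha>\<close> can be shorter than \<open>height x - 1\<close>.\<close>
definition is_short :: "'v \<Rightarrow> ('v \<Rightarrow> 'v) \<Rightarrow> bool" where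
  "is_short x w \<longleftrightarrow> (\<exists>bs. set bs \<subseteq> B \<and> real (length bs) = height x - 1 \<and> w = word bs \<and> w x = \<alpha>)"

lemma is_short_alpha: "is_short \<alpha> w \<longleftrightarrow> w = id"
  using alpha unfolding is_short_def by auto

lemma is_short_step:
  assumes "b \<in> B" "pair x b = 1" "is_short (x - b) w"
  shows "is_short x (w \<circ> refl b)"
proof -
  obtain bs where bs: "set bs \<subseteq> B" "real (length bs) = height (x - b) - 1" "w = word bs"
      "w (x - b) = \<alpha>"
    using assms(3) unfolding is_short_def by blast
  have "refl b x = x - b" using assms by (simp add: refl_root simple_root)
  then show ?thesis
    unfolding is_short_def using bs assms
    by (intro exI[of _ "bs @ [b]"]) (simp add: word_append)
qed

text \<open>The last letter of such a word acts first and must lower the height by exactly one, as the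
remaining letters can only make up for the rest.\<close>
lemma is_short_cases:
  assumes "is_short x w" "x \<in> P"
  obtains "x = \<alpha>" "w = id"
  | b w' where "b \<in> B" "pair x b = 1" "x - b \<in> P" "is_short (x - b) w'" "w = w' \<circ> refl b"
proof -
  obtain bs where bs: "set bs \<subseteq> B" "real (length bs) = height x - 1" "w = word bs" "w x = \<alpha>"
    using assms(1) unfolding is_short_def by blast
  show thesis
  proof (cases bs rule: rev_cases)
    case Nil
    then show thesis using bs that(1) by simp
  next
    case (snoc cs b)
    have b: "b \<in> B" "set cs \<subseteq> B" using bs snoc by auto
    have w: "w = word cs \<circ> refl b" using bs snoc by (simp add: word_append)
    have xb: "x \<noteq> b" using bs(2) b snoc by auto
    have r: "refl b x \<in> P" using simple_refl_pos xb assms(2) b by blast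
    have "depth (refl b x) - depth (word cs (refl b x)) \<le> real (length cs)"
      using depth_word b r pos_root by blast
    moreover have wx: "word cs (refl b x) = \<alpha>"
      using bs(4) unfolding w by simp
    moreover have "depth \<alpha> = 0" using alpha simple_pos by (simp add: depth_def)
    ultimately have "height (refl b x) - 1 \<le> height x - 2"
      using bs snoc r by (simp add: depth_def)
    then have "1 \<le> pair x b" using b by (simp add: refl_root simple_root)
    then have p: "pair x b = 1"
      using pair_gt_0[of x b] xb b assms pos_root simple_root by force
    then have rx: "refl b x = x - b" using b by (simp add: refl_root simple_root)
    have "is_short (x - b) (word cs)"
      unfolding is_short_def using bs(2) snoc b wx rx
      by (intro exI[of _ cs]) auto
    then show thesis using that(2) b p r rx w by metis
  qed
qed

lemma is_short_above:
  assumes "is_short x w" "x \<in> P" shows "x \<in> above"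
proof -
  have "x \<in> above" if "real n = height x - 1" "is_short x w" "x \<in> P" for n
    using that
  proof (induction n arbitrary: x w)
    case 0
    from 0(2,3) show ?case
    proof (cases rule: is_short_cases)
      case 1 then show ?thesis using alpha_above by simp
    next
      case (2 b w')
      then show ?thesis using height_pos[of "x - b"] 0 by simp
    qed
  next
    case (Suc n)
    from Suc(3,4) show ?case
    proof (cases rule: is_short_cases)
      case 1 then show ?thesis using alpha_above by simp
    next
      case (2 b w')
      then have "x - b \<in> above" using Suc.IH[of "x - b" w'] Suc.prems by simp
      then show ?thesis using above_add Suc.prems 2 by blast
    qed
  qed
  moreover have "\<exists>n. real n = height x - 1"
    using assms(1) unfolding is_short_def by blast
  ultimately show ?thesis using assms by blast
qed

text \<open>The summands of \<open>2 = pair x x = (\<Sum>b\<in>B. coef b x * pair b x)\<close> show which simple root to subtract: some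
\<open>b \<noteq> \<alpha>\<close> contributes positively, or else \<open>\<alpha>\<close> contributes everything and must have coefficient at
least 2.\<close>
lemma above_descends:
  assumes x: "x \<in> above" "x \<noteq> \<alpha>"
  obtains b where "b \<in> B" "pair x b = 1" "x - b \<in> above"
proof -
  have xr: "x \<in> \<Delta>" and xp: "x \<in> P" using x above_root above_pos by auto
  have xb: "x \<notin> B" using x above_simple by blast
  have sub: "x - b \<in> P \<and> pair x b = 1" if "b \<in> B" "0 < pair b x" for b
  proof -
    have "pair x b = 1"
      using pair_gt_0[of b x] that xb xr simple_root by (metis pair_commute)
    then show ?thesis using simple_sub_pos that xp by blast
  qed
  show thesis
  proof (cases "\<exists>b\<in>B. b \<noteq> \<alpha> \<and> 0 < pair b x")
    case True
    then obtain b where b: "b \<in> B" "b \<noteq> \<alpha>" "0 < pair b x" by blast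
    then have "x - b \<in> above" using sub[of b] x by (auto simp: above_def coef_simple)
    then show thesis using that sub b by blast
  next
    case False
    then have np: "\<And>b. b \<in> B \<Longrightarrow> b \<noteq> \<alpha> \<Longrightarrow> pair b x \<le> 0" by (auto simp: not_less)
    have "2 = (\<Sum>b\<in>B. coef b x * pair b x)"
      using pair_expand[of x x] xr by simp
    also have "\<dots> = coef \<alpha> x * pair \<alpha> x + (\<Sum>b\<in>B - {\<alpha>}. coef b x * pair b x)"
      using alpha finite_simple by (simp add: sum.remove)
    also have "(\<Sum>b\<in>B - {\<alpha>}. coef b x * pair b x) \<le> 0"
      using np coef_nonneg[OF xp] by (intro sum_nonpos) (simp add: mult_nonneg_nonpos)
    finally have *: "2 \<le> coef \<alpha> x * pair \<alpha> x" by simp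
    then have "0 < pair \<alpha> x"
      using coef_nonneg[OF xp alpha] by (smt (verit) mult_nonneg_nonpos)
    then have s: "x - \<alpha> \<in> P" "pair x \<alpha> = 1" using sub alpha by auto
    then have "2 \<le> coef \<alpha> x" using * by (simp add: pair_commute)
    then have "x - \<alpha> \<in> above" using s alpha by (simp add: above_def coef_simple)
    then show thesis using that s alpha by blast
  qed
qed

lemma above_induct [consumes 1, case_names base step]:
  assumes x: "x \<in> above" and "Q \<alpha>"
    and step: "\<And>x b. x \<in> above \<Longrightarrow> b \<in> B \<Longrightarrow> pair x b = 1 \<Longrightarrow> x - b \<in> above \<Longrightarrow> Q (x - b) \<Longrightarrow> Q x"
  shows "Q x"
  using x
proof (induction "nat \<lfloor>height x\<rfloor>" arbitrary: x rule: less_induct)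
  case less
  show ?case
  proof (cases "x = \<alpha>")
    case True then show ?thesis using assms by blast
  next
    case False
    then obtain b where b: "b \<in> B" "pair x b = 1" "x - b \<in> above"
      using above_descends less.prems by blast
    have "nat \<lfloor>height (x - b)\<rfloor> < nat \<lfloor>height x\<rfloor>"
      using height_pos[OF above_pos[OF b(3)]] b by (simp; linarith)
    then have "Q (x - b)" using less b by blast
    then show ?thesis
      using step b less.prems by blast
  qed
qed

lemma is_short_exists: "x \<in> above \<Longrightarrow> \<exists>w. is_short x w"
proof (induction rule: above_induct)
  case base then show ?case using is_short_alpha by blast
next
  case (step x b) then show ?case using is_short_step by blast
qed

text \<open>Diamond argument: if two shortest words start by subtracting different simple roots \<open>b\<close> and \<open>c\<close>,
these are orthogonal, and both words agree with one that subtracts \<open>b\<close> and \<open>c\<close>.\<close>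
lemma is_short_unique:
  assumes "x \<in> P" "is_short x w" "is_short x w'" shows "w = w'"
  using assms
proof (induction "nat \<lfloor>height x\<rfloor>" arbitrary: x w w' rule: less_induct)
  case less
  have IH: "u = u'" if "b \<in> B" "x - b \<in> P" "is_short (x - b) u" "is_short (x - b) u'" for b u u'
  proof -
    have "nat \<lfloor>height (x - b)\<rfloor> < nat \<lfloor>height x\<rfloor>"
      using height_pos[OF that(2)] that(1) by (simp; linarith)
    then show ?thesis using less.hyps that by blast
  qed
  show ?case
  proof (cases "x = \<alpha>")
    case True
    then show ?thesis using less.prems is_short_alpha by simp
  next
    case False
    obtain b u where b: "b \<in> B" "pair x b = 1" "x - b \<in> P" "is_short (x - b) u" "w = u \<circ> refl b"
      using is_short_cases[OF less.prems(2,1)] False by metis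
    obtain c v where c: "c \<in> B" "pair x c = 1" "x - c \<in> P" "is_short (x - c) v" "w' = v \<circ> refl c"
      using is_short_cases[OF less.prems(3,1)] False by metis
    have br: "b \<in> \<Delta>" and cr: "c \<in> \<Delta>" and xr: "x \<in> \<Delta>"
      using b c simple_root less.prems pos_root by auto
    show ?thesis
    proof (cases "b = c")
      case True
      then show ?thesis using IH b c by metis
    next
      case bc: False
      have ab: "x - b \<in> above" "x - c \<in> above" using is_short_above b c by blast+
      have "b - c \<notin> \<Delta>"
        using pos_or_neg[of "b - c"] b c bc by (auto simp: pos_iff coef_simple split: if_splits)
      then have "pair b c \<noteq> 1" using diff_root_iff br cr by blast
      moreover have "pair b c \<noteq> 2" using pair_eq_2 br cr bc by blast
      moreover have "pair b c \<noteq> - 2"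
        using pair_eq_minus_2[OF br cr] b(1) c(1) not_pos_and_neg simple_pos by metis
      \<comment> \<open>Otherwise \<open>x = b + c\<close>, and subtracting \<open>b\<close> or \<open>c\<close> could not both leave \<open>\<alpha>\<close>.\<close>
      moreover have "pair b c \<noteq> - 1"
      proof
        assume *: "pair b c = - 1"
        then have s: "b + c \<in> \<Delta>" using add_root_iff br cr by blast
        have "pair x (b + c) = 2" using b c by simp
        then have "x = b + c" using pair_eq_2 xr s by blast
        then have "c = \<alpha>" "b = \<alpha>" using ab above_simple b c by auto
        then show False using bc by simp
      qed
      ultimately have p: "pair b c = 0"
        by (cases rule: pair_cases[OF br cr]) auto
      have comm: "refl b \<circ> refl c = refl c \<circ> refl b"
        using p br cr by (simp add: fun_eq_iff refl_root pair_commute[of c b])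
      have "x - b - c \<in> P"
        using simple_sub_pos[of c "x - b"] b c p by simp
      moreover have "1 \<le> coef \<alpha> (x - b - c)"
        using ab b c bc alpha by (auto simp: above_def coef_simple split: if_splits)
      ultimately have "x - b - c \<in> above" by (simp add: above_def)
      then obtain y where y: "is_short (x - b - c) y" using is_short_exists by blast
      have "is_short (x - b) (y \<circ> refl c)"
        using is_short_step[of c "x - b"] y b c p by simp
      then have u: "u = y \<circ> refl c" using IH b by blast
      have "is_short (x - c - b) y" using y by (simp add: algebra_simps)
      then have "is_short (x - c) (y \<circ> refl b)"
        using is_short_step[of b "x - c"] b c p by (simp add: pair_commute[of c b])
      then have "v = y \<circ> refl b" using IH c by blast
      then show ?thesis using u b c comm by (simp add: comp_assoc)
    qed
  qed
qed

abbreviation shortest :: "'v \<Rightarrow> 'v \<Rightarrow> 'v" where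
  "shortest x \<equiv> shortest_to \<Delta> B x \<alpha>"

text \<open>Words attaining the lower bound exist for roots above \<open>\<alpha>\<close> and are unique as maps, so they compute the
definite description of the shortest element.\<close>
lemma is_short_shortest:
  assumes "x \<in> above" shows "is_short x (shortest x)"
proof -
  obtain w where w: "is_short x w" using is_short_exists assms by blast
  have depth: "depth x = height x - 1" "depth \<alpha> = 0"
    using assms above_pos alpha_above alpha by (auto simp: depth_def)
  have lower: "height x - 1 \<le> real (weyl_length B u)" if "u \<in> weyl \<Delta>" "u x = \<alpha>" for u
    using weyl_length_word[OF that(1)] depth_word[of _ x] that(2) depth above_root[OF assms]
    by (metis diff_zero)
  obtain bs where bs: "set bs \<subseteq> B" "real (length bs) = height x - 1" "w = word bs" "w x = \<alpha>"
    using w unfolding is_short_def by blast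
  have ww: "w \<in> weyl \<Delta>" using word_in_weyl bs by blast
  have wl: "real (weyl_length B w) \<le> height x - 1"
    using weyl_length_le bs by (metis of_nat_le_iff)
  have "shortest x = w"
    unfolding shortest_to_def
  proof (rule the_equality)
    show "w \<in> weyl \<Delta> \<and> w x = \<alpha> \<and>
      (\<forall>w'\<in>weyl \<Delta>. w' x = \<alpha> \<longrightarrow> weyl_length B w \<le> weyl_length B w')"
      using ww bs(4) wl lower by (meson of_nat_le_iff order_trans)
  next
    fix u assume u: "u \<in> weyl \<Delta> \<and> u x = \<alpha> \<and>
      (\<forall>w'\<in>weyl \<Delta>. w' x = \<alpha> \<longrightarrow> weyl_length B u \<le> weyl_length B w')"
    then have "weyl_length B u \<le> weyl_length B w" using ww bs by blast
    then have l: "real (weyl_length B u) = height x - 1" using lower[of u] u wl by linarith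
    obtain cs where "set cs \<subseteq> B" "length cs = weyl_length B u" "u = word cs"
      using weyl_length_word u by blast
    then have "is_short x u" unfolding is_short_def using l u by metis
    then show "u = w" using is_short_unique w assms above_pos by blast
  qed
  then show ?thesis using w by simp
qed

lemma shortest_alpha: "shortest \<alpha> = id"
  using is_short_shortest alpha_above is_short_alpha by blast

lemma shortest_step:
  assumes "x \<in> P" "b \<in> B" "pair x b = 1" "x - b \<in> above"
  shows "shortest x = shortest (x - b) \<circ> refl b"
proof -
  have "is_short x (shortest (x - b) \<circ> refl b)" using is_short_step is_short_shortest assms by blast
  moreover have "is_short x (shortest x)" using is_short_shortest above_add assms by blast
  ultimately show ?thesis using is_short_unique assms by blast
qed

lemma shortest_weyl: "x \<in> above \<Longrightarrow> shortest x \<in> weyl \<Delta>"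
  using is_short_shortest word_in_weyl unfolding is_short_def by metis

lemma shortest_apply: "x \<in> above \<Longrightarrow> shortest x x = \<alpha>"
  using is_short_shortest unfolding is_short_def by blast

lemma shortest_root: "x \<in> above \<Longrightarrow> y \<in> \<Delta> \<Longrightarrow> shortest x y \<in> \<Delta>"
  using shortest_weyl weyl_root by blast

lemma shortest_minus: "x \<in> above \<Longrightarrow> shortest x (- y) = - shortest x y"
  using shortest_weyl weyl_minus by blast

lemma shortest_add: "x \<in> above \<Longrightarrow> shortest x (y + z) = shortest x y + shortest x z"
  using shortest_weyl weyl_add by blast

text \<open>A simple root is not a sum of two positive roots, and a positive root is not a sum of two negative
ones.\<close>
lemma sum_simple_one_neg:
  assumes "x \<in> \<Delta>" "y \<in> \<Delta>" "x + y = \<alpha>" shows "- x \<in> P \<longleftrightarrow> y \<in> P"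
proof
  assume "- x \<in> P"
  show "y \<in> P"
  proof (rule ccontr)
    assume "y \<notin> P"
    then have "- y \<in> P" using pos_or_neg assms by blast
    have "- x + - y = - \<alpha>" using assms(3) by (metis minus_add_distrib)
    then have "- \<alpha> \<in> P"
      using pos_add[OF \<open>- x \<in> P\<close> \<open>- y \<in> P\<close>] alpha_root neg_root by simp
    then show False using alpha simple_pos not_pos_and_neg by blast
  qed
next
  assume "y \<in> P"
  show "- x \<in> P"
  proof (rule ccontr)
    assume "- x \<notin> P"
    then have "x \<in> P" using pos_or_neg assms by blast
    then have "2 \<le> height (x + y)" using height_pos[of x] height_pos[of y] \<open>y \<in> P\<close> by simp
    then show False using assms alpha by simp
  qed
qed

text \<open>Exactly one half of each decomposition \<open>x = y + (x - y)\<close> is inverted, since the images add up to \<open>\<alpha>\<close>.\<close>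
lemma shortest_complement:
  assumes "x \<in> above" "y \<in> \<Delta>" "x - y \<in> \<Delta>"
  shows "- shortest x y \<in> P \<longleftrightarrow> shortest x (x - y) \<in> P"
proof (rule sum_simple_one_neg)
  have "shortest x (y + (x - y)) = \<alpha>" using shortest_apply assms by simp
  then show "shortest x y + shortest x (x - y) = \<alpha>" using shortest_add assms by metis
qed (use shortest_root assms in auto)

text \<open>Each step inverts the simple root being subtracted, which pairs to 1 with the current root, and
reflections preserve the pairing.\<close>
lemma shortest_inverted_pair:
  assumes "x \<in> above" "y \<in> P" "- shortest x y \<in> P" shows "pair y x = 1"
  using assms
proof (induction arbitrary: y rule: above_induct)
  case base
  then show ?case using shortest_alpha not_pos_and_neg by auto
next
  case (step x b)
  have e: "shortest x y = shortest (x - b) (refl b y)" using shortest_step step above_pos by simp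
  show ?case
  proof (cases "y = b")
    case True
    then show ?thesis using step by (simp add: pair_commute)
  next
    case False
    then have "refl b y \<in> P" using simple_refl_pos step by blast
    then have "pair (refl b y) (x - b) = 1" using step e by metis
    moreover have "x - b = refl b x" using step by (simp add: refl_root simple_root)
    ultimately show ?thesis using pair_refl step simple_root by simp
  qed
qed

text \<open>On the way from \<open>x\<close> down to \<open>\<alpha>\<close> the half \<open>y\<close> without \<open>\<alpha>\<close> keeps that property until it has been used up.
Only a step subtracting \<open>\<alpha>\<close> could spoil this, but such a step leaves \<open>y\<close> unchanged.\<close>
lemma shortest_inverts_off_support:
  assumes "x \<in> above" "y \<in> P" "x - y \<in> P" "coef \<alpha> y = 0" shows "- shortest x y \<in> P"
  using assms
proof (induction arbitrary: y rule: above_induct)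
  case base
  then show ?case using height_pos[of y] height_pos[of "\<alpha> - y"] base alpha by simp
next
  case (step x b)
  have bp: "b \<in> \<Delta>" "b \<in> P" using step simple_root simple_pos by auto
  have xr: "x \<in> \<Delta>" "y \<in> \<Delta>" "x \<in> P" using step above_root above_pos pos_root by auto
  have e: "shortest x z = shortest (x - b) (refl b z)" for z using shortest_step step above_pos by simp
  have pxy: "pair x y = 1" using diff_root_iff xr step pos_root by blast
  show ?case
  proof (cases "y = b")
    case True
    have "- shortest (x - b) b \<notin> P"
      using shortest_inverted_pair[of "x - b" b] step bp by (auto simp: pair_commute)
    then have "shortest (x - b) b \<in> P" using pos_or_neg shortest_root step bp by blast
    then show ?thesis using True e[of b] bp shortest_minus step by simp
  next
    case yb: False
    have ry: "refl b y \<in> P" using simple_refl_pos step yb by blast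
    have "x - b = refl b x" using step by (simp add: refl_root simple_root)
    then have eq: "x - b - refl b y = refl b (x - y)" by (simp add: refl_diff)
    have coef: "coef \<alpha> (refl b y) = 0 \<and> x - y \<noteq> b"
    proof (cases "b = \<alpha>")
      case False
      then have "coef \<alpha> (refl b y) = 0" using step bp by (simp add: refl_root coef_simple)
      moreover have "x - y \<noteq> b"
      proof
        assume "x - y = b"
        then have "coef \<alpha> x = 0" using step False by (metis add_0 coef_add coef_simple diff_add_cancel)
        then show False using step by (simp add: above_def)
      qed
      ultimately show ?thesis by simp
    next
      case True
      \<comment> \<open>As \<open>x - \<alpha>\<close> still contains \<open>\<alpha>\<close>, \<open>x\<close> is not \<open>y + \<alpha>\<close>; hence \<open>y\<close> is orthogonal to \<open>\<alpha>\<close>.\<close>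
      have c2: "2 \<le> coef \<alpha> x" using step True by (simp add: above_def coef_simple)
      have "x - y \<noteq> b"
      proof
        assume "x - y = b"
        then have "coef \<alpha> x = 1"
          using step True by (metis add.right_neutral coef_add coef_simple diff_add_cancel)
        then show False using c2 by simp
      qed
      moreover have "pair y b = 0"
      proof (cases rule: pair_cases[OF xr(2) bp(1)])
        case 1 then show ?thesis using yb by simp
      next
        case 2
        then have "y - b \<in> P" using simple_sub_pos step by blast
        then have "0 \<le> coef \<alpha> (y - b)" using coef_nonneg alpha by blast
        then show ?thesis using step True by (simp add: coef_simple)
      next
        case 3 then show ?thesis .
      next
        case 4
        then have r: "y + b \<in> \<Delta>" using add_root_iff xr bp by blast
        have "pair x (y + b) = 2" using pxy step by simp
        then have "x = y + b" using pair_eq_2 xr r by blast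
        then show ?thesis using calculation by simp
      next
        case 5 then show ?thesis using step bp not_pos_and_neg by blast
      qed
      ultimately show ?thesis using step bp by (simp add: refl_root)
    qed
    then have "x - b - refl b y \<in> P"
      unfolding eq using simple_refl_pos step by blast
    then have "- shortest (x - b) (refl b y) \<in> P" using step.IH ry coef by blast
    then show ?thesis using e by simp
  qed
qed

end

section \<open>The affine Weyl group\<close>

context ade_root_system begin

abbreviation AP :: "('v \<times> real) set" where "AP \<equiv> aff_roots_pos \<Delta> B"

definition aff_roots :: "('v \<times> real) set" where
  "aff_roots = {x. fst x \<in> \<Delta> \<and> snd x \<in> \<int>}"

definition aff_simple :: "('v \<times> real) set" where
  "aff_simple = insert (alpha0 \<theta>) ((\<lambda>b. (b, 0)) ` B)"

definition apair :: "'v \<times> real \<Rightarrow> 'v \<times> real \<Rightarrow> real" where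
  "apair x y = pair (fst x) (fst y)"

lemma aff_pos_iff:
  "x \<in> AP \<longleftrightarrow> fst x \<in> \<Delta> \<and> snd x \<in> \<int> \<and> (0 < snd x \<or> (snd x = 0 \<and> fst x \<in> P))"
  unfolding aff_roots_pos_def by (cases x) (auto elim!: Ints_cases)

lemma aff_pos_root: "x \<in> AP \<Longrightarrow> x \<in> aff_roots"
  by (simp add: aff_pos_iff aff_roots_def)

lemma aff_pos_or_neg: "x \<in> aff_roots \<Longrightarrow> x \<in> AP \<or> - x \<in> AP"
  using pos_or_neg[of "fst x"] by (auto simp: aff_pos_iff aff_roots_def neg_root)

lemma aff_not_pos_and_neg: "x \<in> AP \<Longrightarrow> - x \<notin> AP"
  using not_pos_and_neg by (auto simp: aff_pos_iff)

lemma aff_pos_add: "x \<in> AP \<Longrightarrow> y \<in> AP \<Longrightarrow> x + y \<in> aff_roots \<Longrightarrow> x + y \<in> AP"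
  using pos_add[of "fst x" "fst y"] by (auto simp: aff_pos_iff aff_roots_def)

lemma finite_root_aff_pos: "(x, 0) \<in> AP \<longleftrightarrow> x \<in> P"
  by (auto simp: aff_pos_iff pos_root)

lemma aff_simple_pos: "s \<in> aff_simple \<Longrightarrow> s \<in> AP"
  by (auto simp: aff_simple_def aff_pos_iff alpha0_def simple_pos simple_root theta_root neg_root)

lemma aff_simple_root: "s \<in> aff_simple \<Longrightarrow> s \<in> aff_roots"
  using aff_simple_pos aff_pos_root by blast

lemma aff_refl_root: "s \<in> aff_roots \<Longrightarrow> aff_refl s x = x - apair x s *\<^sub>R s"
  by (simp add: aff_refl_def apair_def pair_def root_norm aff_roots_def)

lemma apair_simps [simp]:
  "apair (x + y) z = apair x z + apair y z" "apair z (x + y) = apair z x + apair z y"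
  "apair (x - y) z = apair x z - apair y z" "apair z (x - y) = apair z x - apair z y"
  "apair (- x) z = - apair x z" "apair z (- x) = - apair z x"
  "apair (c *\<^sub>R x) z = c * apair x z" "apair z (c *\<^sub>R x) = c * apair z x"
  by (simp_all add: apair_def)

lemma apair_commute: "apair x y = apair y x"
  by (simp add: apair_def pair_commute)

lemma apair_self [simp]: "x \<in> aff_roots \<Longrightarrow> apair x x = 2"
  by (simp add: apair_def aff_roots_def)

lemma apair_int: "x \<in> aff_roots \<Longrightarrow> y \<in> aff_roots \<Longrightarrow> apair x y \<in> \<int>"
  by (simp add: apair_def aff_roots_def pair_int)

lemma aff_refl_in_roots: "s \<in> aff_roots \<Longrightarrow> x \<in> aff_roots \<Longrightarrow> aff_refl s x \<in> aff_roots"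
  using refl_in_roots[of "fst s" "fst x"] apair_int[of x s]
  by (simp add: aff_refl_root) (simp add: aff_roots_def refl_root apair_def)

lemma aff_refl_add: "aff_refl s (x + y) = aff_refl s x + aff_refl s y"
  and aff_refl_minus: "aff_refl s (- x) = - aff_refl s x"
  by (simp_all add: aff_refl_def inner_add_left add_divide_distrib algebra_simps)

lemma aff_refl_refl [simp]: "s \<in> aff_roots \<Longrightarrow> aff_refl s (aff_refl s x) = x"
  by (simp add: aff_refl_root)

lemma aff_refl_self [simp]: "s \<in> aff_roots \<Longrightarrow> aff_refl s s = - s"
  by (simp add: aff_refl_root scaleR_2)

lemma apair_refl: "s \<in> aff_roots \<Longrightarrow> apair (aff_refl s x) (aff_refl s y) = apair x y"
  by (simp add: aff_refl_root algebra_simps apair_commute[of s y])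

lemma aff_refl_fixes_delta: "aff_refl s (0, c) = (0, c)"
  by (simp add: aff_refl_def)

lemma aff_refl_finite: "b \<in> \<Delta> \<Longrightarrow> aff_refl (b, 0) x = (refl b (fst x), snd x)"
  by (simp add: aff_refl_def refl_def prod_eq_iff)

text \<open>For the reflection in \<open>\<alpha>\<^sub>0 = \<delta> - \<theta>\<close> the image of \<open>y + k\<delta>\<close> is \<open>(y - pair y \<theta> \<theta>) + (k + pair y \<theta>)\<delta>\<close>. Here
\<open>pair y \<theta>\<close> is at least -1 unless \<open>y = - \<theta>\<close>, and in the borderline cases the finite part that is left
is positive because \<open>\<theta>\<close> is the highest root.\<close>
lemma aff_simple_refl_pos:
  assumes "s \<in> aff_simple" "x \<in> AP" "x \<noteq> s" shows "aff_refl s x \<in> AP"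
proof -
  have sr: "s \<in> aff_roots" and xr: "x \<in> aff_roots"
    using assms aff_simple_root aff_pos_root by auto
  have r: "aff_refl s x \<in> aff_roots" using aff_refl_in_roots sr xr by blast
  consider b where "b \<in> B" "s = (b, 0)" | "s = (- \<theta>, 1)"
    using assms(1) by (auto simp: aff_simple_def alpha0_def)
  then show ?thesis
  proof cases
    case 1
    then have e: "aff_refl s x = (refl b (fst x), snd x)" by (simp add: aff_refl_finite simple_root)
    show ?thesis
    proof (cases "snd x = 0")
      case True
      then have "fst x \<in> P" "fst x \<noteq> b" using assms 1 by (auto simp: aff_pos_iff prod_eq_iff)
      then show ?thesis using True simple_refl_pos[OF 1(1)] e by (simp add: finite_root_aff_pos)
    next
      case False
      then show ?thesis using assms(2) r e by (auto simp: aff_pos_iff aff_roots_def)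
    qed
  next
    case 2
    define k where "k = snd x"
    define y where "y = fst x"
    have y: "y \<in> \<Delta>" "k \<in> \<int>" using xr by (auto simp: y_def k_def aff_roots_def)
    have e: "aff_refl s x = (y - pair y \<theta> *\<^sub>R \<theta>, k + pair y \<theta>)"
      unfolding aff_refl_root[OF sr] unfolding 2 y_def k_def
      by (simp add: apair_def prod_eq_iff)
    have pos: "0 < k \<or> (k = 0 \<and> y \<in> P)" using assms(2) by (auto simp: aff_pos_iff y_def k_def)
    have k1: "1 \<le> k" if "0 < k" using that y(2) by (auto elim!: Ints_cases)
    have goal: ?thesis if "0 < k + pair y \<theta> \<or> k + pair y \<theta> = 0 \<and> y - pair y \<theta> *\<^sub>R \<theta> \<in> P"
      using that r unfolding e by (auto simp: aff_pos_iff aff_roots_def)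
    show ?thesis
    proof (cases "k = 0")
      case True
      then have "y \<in> P" using pos by simp
      then show ?thesis using theta_pair_nonneg[of y] True by (intro goal) auto
    next
      case False
      then have k: "1 \<le> k" using pos k1 by blast
      show ?thesis
      proof (cases rule: pair_cases[OF y(1) theta_root])
        case 4
        have "y + \<theta> \<in> \<Delta>" using add_root_iff 4 y theta_root by blast
        moreover have "0 \<le> coef b (y + \<theta>)" if "b \<in> B" for b
          using theta_ge[of "- y" b] that y neg_root by simp
        ultimately have "y + \<theta> \<in> P" by (simp add: pos_iff)
        then show ?thesis using k 4 by (intro goal) auto
      next
        case 5
        have "k \<noteq> 1" using assms(3) 2 5 by (auto simp: y_def k_def prod_eq_iff)
        then have "2 \<le> k" using k y(2) by (auto elim!: Ints_cases)
        then show ?thesis using 5 theta_pos by (intro goal) (auto simp: scaleR_2)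
      qed (use k in \<open>intro goal; simp\<close>)+
    qed
  qed
qed

definition aword :: "('v \<times> real) list \<Rightarrow> 'v \<times> real \<Rightarrow> 'v \<times> real" where
  "aword ss = foldr (\<circ>) (map aff_refl ss) id"

lemma aword_simps [simp]: "aword [] = id" "aword (s # ss) = aff_refl s \<circ> aword ss"
  by (simp_all add: aword_def)

lemma aword_append: "aword (as @ bs) = aword as \<circ> aword bs"
  by (induction as) (simp_all add: comp_assoc)

definition aff_group :: "('v \<times> real \<Rightarrow> 'v \<times> real) set" where
  "aff_group = {aword ss |ss. set ss \<subseteq> aff_simple}"

lemma id_in_group: "id \<in> aff_group"
  unfolding aff_group_def by (auto intro!: exI[of _ "[]"])

lemma group_comp: "u \<in> aff_group \<Longrightarrow> v \<in> aff_group \<Longrightarrow> u \<circ> v \<in> aff_group"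
  unfolding aff_group_def by clarsimp (metis aword_append le_sup_iff set_append)

lemma aff_refl_in_group: "s \<in> aff_simple \<Longrightarrow> aff_refl s \<in> aff_group"
  unfolding aff_group_def by (auto intro!: exI[of _ "[s]"])

text \<open>The finite Weyl group is generated by simple reflections, so the affine Weyl group is generated by
the reflections in the affine simple roots.\<close>
lemma weyl_in_aff_group: "w \<in> weyl \<Delta> \<Longrightarrow> map_prod w id \<in> aff_group"
proof -
  assume "w \<in> weyl \<Delta>"
  then obtain bs where bs: "set bs \<subseteq> B" "w = word bs" using weyl_is_word by blast
  have "aword (map (\<lambda>b. (b, 0)) bs) x = (word bs (fst x), snd x)" for x
    using bs(1) by (induction bs) (simp_all add: aff_refl_finite simple_root)
  then have "map_prod w id = aword (map (\<lambda>b. (b, 0)) bs)"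
    using bs(2) by (simp add: fun_eq_iff map_prod_def split_beta)
  moreover have "set (map (\<lambda>b. (b, 0)) bs) \<subseteq> aff_simple"
    using bs(1) by (auto simp: aff_simple_def)
  ultimately show ?thesis
    unfolding aff_group_def by blast
qed

lemma aff_weyl_in_group: "w \<in> aff_weyl \<Delta> \<theta> \<Longrightarrow> w \<in> aff_group"
  unfolding aff_weyl_def
proof (induction rule: gen_maps.induct)
  case gen_id then show ?case by (rule id_in_group)
next
  case (gen_step s w)
  have "s \<in> aff_group"
    using gen_step(1) weyl_in_aff_group aff_refl_in_group[of "alpha0 \<theta>"] by (auto simp: aff_simple_def)
  then show ?case using group_comp gen_step by blast
qed

lemma group_induct [consumes 1, case_names id refl]:
  assumes "u \<in> aff_group" "Q id"
    and "\<And>s u. s \<in> aff_simple \<Longrightarrow> u \<in> aff_group \<Longrightarrow> Q u \<Longrightarrow> Q (aff_refl s \<circ> u)"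
  shows "Q u"
proof -
  obtain ss where ss: "set ss \<subseteq> aff_simple" "u = aword ss" using assms(1) unfolding aff_group_def by blast
  from ss(1) have "Q (aword ss)"
    by (induction ss) (auto simp: assms(2) aff_group_def intro!: assms(3))
  then show ?thesis using ss by simp
qed

lemma group_add: "u \<in> aff_group \<Longrightarrow> u (x + y) = u x + u y"
  by (induction rule: group_induct) (auto simp: aff_refl_add)

lemma group_minus: "u \<in> aff_group \<Longrightarrow> u (- x) = - u x"
  by (induction rule: group_induct) (auto simp: aff_refl_minus)

lemma group_fixes_delta: "u \<in> aff_group \<Longrightarrow> u (0, c) = (0, c)"
  by (induction rule: group_induct) (auto simp: aff_refl_fixes_delta)

lemma group_root: "u \<in> aff_group \<Longrightarrow> x \<in> aff_roots \<Longrightarrow> u x \<in> aff_roots"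
  by (induction rule: group_induct) (auto simp: aff_refl_in_roots aff_simple_root)

lemma group_apair: "u \<in> aff_group \<Longrightarrow> apair (u x) (u y) = apair x y"
  by (induction rule: group_induct) (auto simp: apair_refl aff_simple_root)

lemma group_scale: "u \<in> aff_group \<Longrightarrow> u (c *\<^sub>R x) = c *\<^sub>R u x"
  by (induction rule: group_induct) (auto simp: aff_refl_def algebra_simps)

lemma group_diff: "u \<in> aff_group \<Longrightarrow> u (x - y) = u x - u y"
  using group_add[of u x "- y"] group_minus[of u y] by simp

lemma group_conj:
  assumes "u \<in> aff_group" "s \<in> aff_roots"
  shows "aff_refl (u s) \<circ> u = u \<circ> aff_refl s"
proof
  fix x
  have "u s \<in> aff_roots" using group_root assms by blast
  then show "(aff_refl (u s) \<circ> u) x = (u \<circ> aff_refl s) x"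
    using assms by (simp add: aff_refl_root group_apair group_diff group_scale)
qed

text \<open>Applying the letters one by one, the root turns negative at some letter \<open>t\<close>; just before, it must
equal the simple root \<open>t\<close>, the only positive root that the reflection in \<open>t\<close> makes negative.\<close>
lemma exchange:
  assumes "set ss \<subseteq> aff_simple" "x \<in> AP" "- aword ss x \<in> AP"
  shows "\<exists>as t cs. ss = as @ t # cs \<and> aword cs x = t"
  using assms(1,3)
proof (induction ss)
  case Nil
  then show ?case using assms(2) aff_not_pos_and_neg by auto
next
  case (Cons s ss)
  have g: "aword ss \<in> aff_group" using Cons unfolding aff_group_def by auto
  show ?case
  proof (cases "- aword ss x \<in> AP")
    case True
    moreover have "set ss \<subseteq> aff_simple" using Cons.prems(1) by simp
    ultimately obtain as t cs where "ss = as @ t # cs \<and> aword cs x = t" using Cons.IH by blast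
    then show ?thesis by (intro exI[of _ "s # as"] exI[of _ t] exI[of _ cs]) simp
  next
    case False
    then have p: "aword ss x \<in> AP"
      using aff_pos_or_neg group_root[OF g] assms(2) aff_pos_root by blast
    have "aword ss x = s"
    proof (rule ccontr)
      assume "aword ss x \<noteq> s"
      then have "aff_refl s (aword ss x) \<in> AP" using aff_simple_refl_pos p Cons by simp
      then show False using Cons.prems(2) aff_not_pos_and_neg by simp
    qed
    then show ?thesis by blast
  qed
qed

text \<open>Otherwise the last letter of a shortest word for \<open>u\<close> could be cancelled against another letter by
the exchange property. This is where it matters that \<open>u\<close> lies in the affine Weyl group itself:
a diagram automorphism permutes the affine simple roots without being the identity.\<close>
lemma group_moves_simple:
  assumes "u \<in> aff_group" "u \<noteq> id"
  shows "\<exists>s\<in>aff_simple. - u s \<in> AP"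
proof -
  have "\<exists>n ss. set ss \<subseteq> aff_simple \<and> u = aword ss \<and> length ss = n"
    using assms(1) unfolding aff_group_def by blast
  then have "\<exists>ss. set ss \<subseteq> aff_simple \<and> u = aword ss \<and>
      length ss = (LEAST n. \<exists>ss. set ss \<subseteq> aff_simple \<and> u = aword ss \<and> length ss = n)"
    by (rule LeastI_ex)
  then obtain ss where ss: "set ss \<subseteq> aff_simple" "u = aword ss"
    and least: "length ss = (LEAST n. \<exists>ss. set ss \<subseteq> aff_simple \<and> u = aword ss \<and> length ss = n)"
    by blast
  have min: "length ss \<le> length ts" if "set ts \<subseteq> aff_simple" "u = aword ts" for ts
    unfolding least by (rule Least_le) (use that in blast)
  show ?thesis
  proof (cases ss rule: rev_cases)
    case Nil
    then show ?thesis using ss assms by simp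
  next
    case (snoc ys s)
    have s: "s \<in> aff_simple" and ys: "set ys \<subseteq> aff_simple" using ss snoc by auto
    have yg: "aword ys \<in> aff_group" using ys aff_group_def by auto
    have us: "u = aword ys \<circ> aff_refl s" using ss snoc by (simp add: aword_append)
    have "- aword ys s \<notin> AP"
    proof
      assume "- aword ys s \<in> AP"
      then obtain as t cs where d: "ys = as @ t # cs" "aword cs s = t"
        using exchange[of ys s] ys s aff_simple_pos by blast
      have cg: "aword cs \<in> aff_group" using ys d unfolding aff_group_def by auto
      have "aff_refl t \<circ> aword cs = aword cs \<circ> aff_refl s"
        using group_conj[OF cg aff_simple_root[OF s]] d(2) by simp
      then have "u = aword as \<circ> (aword cs \<circ> (aff_refl s \<circ> aff_refl s))"
        unfolding us d(1) aword_append aword_simps by (metis comp_assoc)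
      also have "aff_refl s \<circ> aff_refl s = id" using aff_simple_root[OF s] by (simp add: fun_eq_iff)
      finally have "u = aword (as @ cs)" by (simp only: aword_append comp_id)
      then have "length ss \<le> length (as @ cs)" using min[of "as @ cs"] ys d by auto
      then show False using snoc d by simp
    qed
    then have "aword ys s \<in> AP"
      using aff_pos_or_neg group_root[OF yg] aff_simple_root[OF s] by blast
    then have "- u s \<in> AP" using us s aff_simple_root group_minus[OF yg] by simp
    then show ?thesis using s by blast
  qed
qed

lemma aff_inv_iff: "x \<in> aff_inversions \<Delta> B u \<longleftrightarrow> x \<in> AP \<and> - u x \<in> AP"
  unfolding aff_inversions_def
  by (auto simp: image_iff) (metis minus_minus)

lemma inv_iff: "x \<in> inversions \<Delta> B w \<longleftrightarrow> x \<in> P \<and> - w x \<in> P"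
  unfolding inversions_def
  by (auto simp: image_iff) (metis minus_minus)

lemma inversions_peel:
  assumes "u \<in> aff_group" "s \<in> aff_simple" "s \<in> aff_inversions \<Delta> B u"
  shows "aff_inversions \<Delta> B (u \<circ> aff_refl s) = aff_refl s ` (aff_inversions \<Delta> B u - {s})"
proof -
  have sr: "s \<in> aff_roots" using aff_simple_root assms by blast
  have us: "- u s \<in> AP" using assms by (simp add: aff_inv_iff)
  show ?thesis
  proof (intro equalityI subsetI)
    fix x assume "x \<in> aff_inversions \<Delta> B (u \<circ> aff_refl s)"
    then have x: "x \<in> AP" "- u (aff_refl s x) \<in> AP" by (auto simp: aff_inv_iff)
    have "x \<noteq> s" using x(2) aff_not_pos_and_neg[OF us] sr group_minus[OF assms(1), of s]
      by (metis aff_refl_self)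
    then have "aff_refl s x \<in> AP" using aff_simple_refl_pos assms x by blast
    moreover have "aff_refl s x \<noteq> s"
      using x aff_not_pos_and_neg assms(2) aff_simple_pos sr by (metis aff_refl_refl aff_refl_self)
    ultimately have "aff_refl s x \<in> aff_inversions \<Delta> B u - {s}" using x by (simp add: aff_inv_iff)
    then show "x \<in> aff_refl s ` (aff_inversions \<Delta> B u - {s})"
      using sr by (metis aff_refl_refl image_eqI)
  next
    fix x assume "x \<in> aff_refl s ` (aff_inversions \<Delta> B u - {s})"
    then obtain y where y': "x = aff_refl s y" "y \<in> aff_inversions \<Delta> B u - {s}" by (rule imageE)
    then have y: "x = aff_refl s y" "y \<in> AP" "- u y \<in> AP" "y \<noteq> s"
      by (simp_all add: aff_inv_iff)
    then show "x \<in> aff_inversions \<Delta> B (u \<circ> aff_refl s)"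
      using aff_simple_refl_pos assms(2) sr by (simp add: aff_inv_iff)
  qed
qed

lemma inversions_peel_card:
  assumes "u \<in> aff_group" "s \<in> aff_simple" "s \<in> aff_inversions \<Delta> B u" "finite (aff_inversions \<Delta> B u)"
  shows "finite (aff_inversions \<Delta> B (u \<circ> aff_refl s))"
    "card (aff_inversions \<Delta> B (u \<circ> aff_refl s)) < card (aff_inversions \<Delta> B u)"
proof -
  show "finite (aff_inversions \<Delta> B (u \<circ> aff_refl s))"
    unfolding inversions_peel[OF assms(1-3)] using assms(4) by simp
  have "card (aff_inversions \<Delta> B (u \<circ> aff_refl s)) \<le> card (aff_inversions \<Delta> B u - {s})"
    unfolding inversions_peel[OF assms(1-3)] using assms(4) by (intro card_image_le) simp
  also have "\<dots> < card (aff_inversions \<Delta> B u)"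
    using assms(3,4) by (intro psubset_card_mono) auto
  finally show "card (aff_inversions \<Delta> B (u \<circ> aff_refl s)) < card (aff_inversions \<Delta> B u)" .
qed

text \<open>Any \<open>u \<noteq> id\<close> inverts a simple root \<open>s\<close>. The reflection in \<open>s\<close> fixes \<open>y\<close>, and \<open>u \<circ> aff_refl s\<close> has one
inversion less, all of them still orthogonal to \<open>y\<close>.\<close>
lemma fixes_orthogonal_to_inversions:
  assumes "u \<in> aff_group" "finite (aff_inversions \<Delta> B u)"
    and "\<And>x. x \<in> aff_inversions \<Delta> B u \<Longrightarrow> apair x y = 0"
  shows "u y = y"
  using assms
proof (induction "card (aff_inversions \<Delta> B u)" arbitrary: u rule: less_induct)
  case less
  show ?case
  proof (cases "u = id")
    case False
    then obtain s where s: "s \<in> aff_simple" "s \<in> aff_inversions \<Delta> B u"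
      using group_moves_simple less.prems(1) aff_simple_pos by (metis aff_inv_iff)
    have sr: "s \<in> aff_roots" using s aff_simple_root by blast
    have sy: "aff_refl s y = y"
      using less.prems(3)[OF s(2)] sr by (simp add: aff_refl_root apair_commute)
    have "apair x y = 0" if x: "x \<in> aff_inversions \<Delta> B (u \<circ> aff_refl s)" for x
    proof -
      obtain z where z: "x = aff_refl s z" "z \<in> aff_inversions \<Delta> B u"
        using x unfolding inversions_peel[OF less.prems(1) s] by blast
      have "apair x y = apair (aff_refl s z) (aff_refl s y)" using sy z by simp
      then show ?thesis using apair_refl[OF sr] less.prems(3)[OF z(2)] by simp
    qed
    moreover have "u \<circ> aff_refl s \<in> aff_group"
      using group_comp aff_refl_in_group less.prems(1) s by blast
    ultimately have "(u \<circ> aff_refl s) y = y"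
      using less.hyps inversions_peel_card[OF less.prems(1) s less.prems(2)] by blast
    then show ?thesis using sy by simp
  qed simp
qed

end

context ade_simple_root begin

text \<open>Peel off finite simple inversions \<open>b\<close>: each of them lowers \<open>x\<close> to \<open>x - b\<close>, exactly as in the recursion
for \<open>shortest\<close>, and preserves the two conditions on pairings. When none is left, all inversions
are orthogonal to the current root, which is then fixed and hence equal to \<open>\<alpha>\<close>.\<close>
lemma affine_to_finite_inversions:
  assumes "u \<in> aff_group" "x \<in> P" "u (x, 0) = (\<alpha>, 0)" "finite (aff_inversions \<Delta> B u)"
    and fin: "\<And>y. (y, 0) \<in> aff_inversions \<Delta> B u \<Longrightarrow> pair y x = 1"
    and aff: "\<And>y k. (y, k) \<in> aff_inversions \<Delta> B u \<Longrightarrow> k \<noteq> 0 \<Longrightarrow> pair y x = 0"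
  shows "x \<in> above \<and> (\<forall>y\<in>P. (y, 0) \<in> aff_inversions \<Delta> B u \<longleftrightarrow> - shortest x y \<in> P)"
  using assms
proof (induction "card (aff_inversions \<Delta> B u)" arbitrary: u x rule: less_induct)
  case less
  note prems = less.prems
  have xr: "x \<in> \<Delta>" using prems pos_root by blast
  show ?case
  proof (cases "\<exists>b\<in>B. (b, 0) \<in> aff_inversions \<Delta> B u")
    case True
    then obtain b where b: "b \<in> B" "(b, 0) \<in> aff_inversions \<Delta> B u" by blast
    have br: "b \<in> \<Delta>" "b \<in> P" using b simple_root simple_pos by auto
    have s: "(b, 0) \<in> aff_simple" using b by (simp add: aff_simple_def)
    have sr: "(b, 0) \<in> aff_roots" using s aff_simple_root by blast
    let ?s = "aff_refl (b, 0)"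
    let ?v = "u \<circ> ?s"
    have bx: "pair x b = 1" using prems(5)[OF b(2)] by (simp add: pair_commute)
    have rx: "refl b x = x - b" using bx br by (simp add: refl_root)
    have xb: "x - b \<in> P" using simple_sub_pos b prems(2) bx by blast
    have se: "?s (y, k) = (refl b y, k)" for y k using br by (simp add: aff_refl_finite)
    have e: "?s (x - b, 0) = (x, 0)"
      using refl_refl[OF br(1), of x] rx by (simp add: se)
    have vg: "?v \<in> aff_group"
      using group_comp aff_refl_in_group prems(1) s by blast
    have inv: "aff_inversions \<Delta> B ?v = ?s ` (aff_inversions \<Delta> B u - {(b, 0)})"
      by (rule inversions_peel[OF prems(1) s b(2)])
    have mem: "(y, k) \<in> aff_inversions \<Delta> B ?v \<longleftrightarrow>
        (refl b y, k) \<in> aff_inversions \<Delta> B u \<and> (refl b y, k) \<noteq> (b, 0)" for y k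
    proof -
      have "(y, k) \<in> aff_inversions \<Delta> B ?v \<longleftrightarrow> ?s (y, k) \<in> aff_inversions \<Delta> B u - {(b, 0)}"
        unfolding inv using aff_refl_refl[OF sr] by (metis (no_types, lifting) image_iff)
      then show ?thesis by (simp add: se)
    qed
    have pr: "pair (refl b y) x = pair y (x - b)" for y
      using pair_refl[OF br(1), of y "x - b"] refl_refl[OF br(1), of x] rx by simp
    have IH: "x - b \<in> above \<and> (\<forall>y\<in>P. (y, 0) \<in> aff_inversions \<Delta> B ?v \<longleftrightarrow> - shortest (x - b) y \<in> P)"
    proof (rule less.hyps)
      show "card (aff_inversions \<Delta> B ?v) < card (aff_inversions \<Delta> B u)" "finite (aff_inversions \<Delta> B ?v)"
        using inversions_peel_card[OF prems(1) s b(2) prems(4)] by auto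
      show "?v (x - b, 0) = (\<alpha>, 0)" using e prems(3) by simp
      show "pair y (x - b) = 1" if "(y, 0) \<in> aff_inversions \<Delta> B ?v" for y
        using that prems(5) unfolding mem pr[symmetric] by blast
      show "pair y (x - b) = 0" if "(y, k) \<in> aff_inversions \<Delta> B ?v" "k \<noteq> 0" for y k
        using that prems(6) unfolding mem pr[symmetric] by blast
    qed (use vg xb in auto)
    have xa: "x \<in> above" using IH above_add prems(2) b by blast
    have she: "shortest x = shortest (x - b) \<circ> refl b" using shortest_step prems(2) b bx IH by blast
    have "(y, 0) \<in> aff_inversions \<Delta> B u \<longleftrightarrow> - shortest x y \<in> P" if y: "y \<in> P" for y
    proof (cases "y = b")
      case True
      have "refl b b \<notin> P" using br not_pos_and_neg by simp
      then have "(b, 0) \<notin> aff_inversions \<Delta> B ?v"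
        unfolding mem by (simp add: aff_inv_iff finite_root_aff_pos)
      then have "- shortest (x - b) b \<notin> P" using IH br by blast
      then have "shortest (x - b) b \<in> P" using pos_or_neg shortest_root IH br by blast
      then have "- shortest x b \<in> P" using she br shortest_minus IH by simp
      then show ?thesis using True b by simp
    next
      case False
      have ry: "refl b y \<in> P" using simple_refl_pos b y False by blast
      have "(refl b y, 0) \<in> aff_inversions \<Delta> B ?v \<longleftrightarrow> (y, 0) \<in> aff_inversions \<Delta> B u"
        unfolding mem using False br by simp
      then show ?thesis using IH ry she by simp
    qed
    then show ?thesis using xa by blast
  next
    case False
    \<comment> \<open>A positive root with positive images of its simple constituents has a positive image.\<close>
    have none: "(y, 0) \<notin> aff_inversions \<Delta> B u" if "y \<in> P" for y
      using that
    proof (induction rule: pos_induct)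
      case (simple b)
      then show ?case using False by blast
    next
      case (step y b)
      have bp: "b \<in> P" using step simple_pos by blast
      have "u (z, 0) \<in> AP" if "z \<in> P" "(z, 0) \<notin> aff_inversions \<Delta> B u" for z
        using that group_root[OF prems(1), of "(z, 0)"] aff_pos_or_neg aff_pos_root
        by (metis aff_inv_iff finite_root_aff_pos)
      then have "u (y, 0) \<in> AP" "u (b, 0) \<in> AP" using step False bp by blast+
      moreover have "u (y + b, 0) = u (y, 0) + u (b, 0)"
        using group_add[OF prems(1), of "(y, 0)" "(b, 0)"] by simp
      moreover have "u (y + b, 0) \<in> aff_roots"
        using group_root prems(1) step finite_root_aff_pos aff_pos_root by blast
      ultimately have "u (y + b, 0) \<in> AP" using aff_pos_add by metis
      then show ?case using aff_not_pos_and_neg aff_inv_iff by blast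
    qed
    have "apair z (x, 0) = 0" if "z \<in> aff_inversions \<Delta> B u" for z
    proof (cases z)
      case (Pair y k)
      have "k \<noteq> 0" using none that Pair by (metis aff_inv_iff finite_root_aff_pos)
      then show ?thesis using prems(6) that Pair by (simp add: apair_def)
    qed
    then have "u (x, 0) = (x, 0)"
      using fixes_orthogonal_to_inversions prems(1,4) by blast
    then have "x = \<alpha>" using prems(3) by simp
    then show ?thesis using alpha_above shortest_alpha none not_pos_and_neg by auto
  qed
qed

end

section \<open>Maximal abelian ideals of positive roots\<close>

text \<open>The root to be adjoined will be a highest one with a given property, so maximality is tested on
enlargements by a single root.\<close>
locale ade_maximal_ideal = ade_simple_root \<Delta> B \<theta> \<alpha>
  for \<Delta> B :: "'v::euclidean_space set" and \<theta> \<alpha> :: 'v +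
  fixes I :: "'v set"
  assumes fibre: "I \<in> tau_fibre \<Delta> B \<theta> \<alpha>"
    and maximal: "\<And>x. comb_abelian_ideal \<Delta> B (insert x I) \<Longrightarrow> x \<in> I"
begin

lemma ideal: "comb_abelian_ideal \<Delta> B I"
  using fibre by (simp add: tau_fibre_def)

lemma ideal_pos: "x \<in> I \<Longrightarrow> x \<in> P"
  using ideal by (auto simp: comb_abelian_ideal_def)

lemma ideal_root: "x \<in> I \<Longrightarrow> x \<in> \<Delta>"
  using ideal_pos pos_root by blast

lemma ideal_up: "x \<in> I \<Longrightarrow> y \<in> P \<Longrightarrow> x + y \<in> \<Delta> \<Longrightarrow> x + y \<in> I"
  using ideal by (auto simp: comb_abelian_ideal_def)

lemma ideal_abelian: "x \<in> I \<Longrightarrow> y \<in> I \<Longrightarrow> x + y \<notin> \<Delta>"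
  using ideal by (auto simp: comb_abelian_ideal_def)

lemma ideal_induct [consumes 1, case_names theta step]:
  assumes x: "x \<in> I" and theta: "\<theta> \<in> I \<Longrightarrow> Q \<theta>"
    and step: "\<And>x b. x \<in> I \<Longrightarrow> b \<in> B \<Longrightarrow> pair x b = - 1 \<Longrightarrow> x + b \<in> I \<Longrightarrow> Q (x + b) \<Longrightarrow> Q x"
  shows "Q x"
  using x
proof (induction "nat \<lfloor>height \<theta> - height x\<rfloor>" arbitrary: x rule: less_induct)
  case less
  show ?case
  proof (cases "x = \<theta>")
    case True then show ?thesis using theta less.prems by blast
  next
    case False
    then obtain b where b: "b \<in> B" "pair x b = - 1" "x + b \<in> P"
      using non_theta_ascends less.prems ideal_pos by blast
    have i: "x + b \<in> I" using ideal_up less.prems b simple_pos pos_root by blast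
    have "height x + 1 \<le> height \<theta>"
    proof -
      have "height (x + b) \<le> height \<theta>"
        unfolding height_def using theta_ge b pos_root by (intro sum_mono) blast
      then show ?thesis using b by simp
    qed
    then have "nat \<lfloor>height \<theta> - height (x + b)\<rfloor> < nat \<lfloor>height \<theta> - height x\<rfloor>"
      using b by (simp; linarith)
    then show ?thesis using less.hyps step less.prems b i by blast
  qed
qed

lemma theta_in_ideal: "\<theta> \<in> I"
proof -
  obtain x where "x \<in> I" using fibre by (auto simp: tau_fibre_def)
  then show ?thesis by (induction rule: ideal_induct)
qed

text \<open>The element \<open>u = w\<^sub>I \<circ> \<sigma>\<^sub>0\<close> takes \<open>\<theta>\<close> to \<open>\<alpha>\<close>, and for \<open>x \<in> I\<close> with \<open>pair x \<theta> = 1\<close> the reflection \<open>\<sigma>\<^sub>0\<close>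
carries the inversion \<open>\<delta> - x\<close> of \<open>w\<^sub>I\<close> to the finite inversion \<open>\<theta> - x\<close> of \<open>u\<close>. So the complementary
half \<open>x\<close> is not inverted.\<close>
lemma theta_above_and_positive:
  "\<theta> \<in> above \<and> (\<forall>x\<in>I. pair x \<theta> = 1 \<longrightarrow> shortest \<theta> x \<in> P)"
proof -
  obtain w where w: "w \<in> aff_weyl \<Delta> \<theta>" "aff_inversions \<Delta> B w = {(- x, 1) |x. x \<in> I}"
      "w (alpha0 \<theta>) + (0, 1) = (\<alpha>, 0)"
    using fibre unfolding tau_fibre_def by blast
  have wg: "w \<in> aff_group" using aff_weyl_in_group w by blast
  let ?s = "alpha0 \<theta>"
  have s: "?s \<in> aff_simple" by (simp add: aff_simple_def)
  have sr: "?s \<in> aff_roots" using aff_simple_root s by blast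
  have sw: "?s \<in> aff_inversions \<Delta> B w" unfolding w(2) alpha0_def using theta_in_ideal by blast
  define u where "u = w \<circ> aff_refl ?s"
  have ug: "u \<in> aff_group" unfolding u_def using group_comp wg aff_refl_in_group s by blast
  have se: "aff_refl ?s (y, k) = (y - pair y \<theta> *\<^sub>R \<theta>, k + pair y \<theta>)" for y k
    unfolding aff_refl_root[OF sr] by (simp add: apair_def alpha0_def)
  have fin: "finite (aff_inversions \<Delta> B w)"
  proof -
    have "{(- x, 1) |x. x \<in> I} = (\<lambda>x. (- x, 1)) ` I" by auto
    moreover have "finite I" using finite_subset[OF _ finite_pos] ideal_pos by blast
    ultimately show ?thesis unfolding w(2) by simp
  qed
  have inv: "aff_inversions \<Delta> B u = aff_refl ?s ` (aff_inversions \<Delta> B w - {?s})"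
    unfolding u_def by (rule inversions_peel[OF wg s sw])
  have invD: "\<exists>x\<in>I. x \<noteq> \<theta> \<and> z = (pair x \<theta> *\<^sub>R \<theta> - x, 1 - pair x \<theta>) \<and> (pair x \<theta> = 0 \<or> pair x \<theta> = 1)"
    if z: "z \<in> aff_inversions \<Delta> B u" for z
  proof -
    obtain x where x: "x \<in> I" "x \<noteq> \<theta>" "z = aff_refl ?s (- x, 1)"
      using z unfolding inv w(2) alpha0_def by blast
    have "pair x \<theta> = 0 \<or> pair x \<theta> = 1"
      using theta_pair_nonneg[OF ideal_pos[OF x(1)]] x(2)
      by (cases rule: pair_cases[OF ideal_root[OF x(1)] theta_root]) auto
    then show ?thesis using x by (intro bexI[of _ x]) (simp_all add: se)
  qed
  have main: "\<theta> \<in> above \<and> (\<forall>y\<in>P. (y, 0) \<in> aff_inversions \<Delta> B u \<longleftrightarrow> - shortest \<theta> y \<in> P)"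
  proof (rule affine_to_finite_inversions[OF ug theta_pos])
    show "finite (aff_inversions \<Delta> B u)" unfolding inv using fin by simp
    have "aff_refl ?s (\<theta>, 0) = ?s + (0, 1)"
      unfolding se using theta_root by (simp add: alpha0_def scaleR_2)
    then have "u (\<theta>, 0) = w (?s + (0, 1))" by (simp add: u_def)
    also have "\<dots> = w ?s + w (0, 1)" by (rule group_add[OF wg])
    also have "w (0, 1) = (0, 1)" by (rule group_fixes_delta[OF wg])
    finally show "u (\<theta>, 0) = (\<alpha>, 0)" using w(3) by simp
    show "pair y \<theta> = 1" if "(y, 0) \<in> aff_inversions \<Delta> B u" for y
      using invD[OF that] theta_root by auto
    show "pair y \<theta> = 0" if "(y, k) \<in> aff_inversions \<Delta> B u" "k \<noteq> 0" for y k
      using invD[OF that(1)] that(2) by auto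
  qed
  have "shortest \<theta> x \<in> P" if x: "x \<in> I" "pair x \<theta> = 1" for x
  proof -
    have r: "\<theta> - x \<in> \<Delta>"
      using diff_root_iff[OF theta_root ideal_root[OF x(1)]] x by (simp add: pair_commute)
    have p: "\<theta> - x \<in> P"
      using r theta_ge[OF ideal_root[OF x(1)]] by (simp add: pos_iff)
    have "(- x, 1) \<noteq> ?s" using x theta_root by (auto simp: alpha0_def)
    then have "(- x, 1) \<in> aff_inversions \<Delta> B w - {?s}" unfolding w(2) using x by blast
    then have "aff_refl ?s (- x, 1) \<in> aff_inversions \<Delta> B u" unfolding inv by (rule imageI)
    then have "(\<theta> - x, 0) \<in> aff_inversions \<Delta> B u" using x by (simp add: se)
    then have "- shortest \<theta> (\<theta> - x) \<in> P" using main p by blast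
    then show ?thesis using shortest_complement[of \<theta> "\<theta> - x"] main r ideal_root[OF x(1)] by simp
  qed
  then show ?thesis using main by blast
qed

text \<open>Descending induction from \<open>\<theta>\<close>. Passing from \<open>x + b\<close> to \<open>x\<close>, the map for \<open>x\<close> is the one for \<open>x + b\<close>
after \<open>refl b\<close>, and \<open>refl b\<close> sends \<open>y \<in> I\<close> either to itself or up to \<open>y + b \<in> I\<close>; the remaining cases
contradict positivity of \<open>x - y\<close>.\<close>
lemma ideal_above_and_positive:
  "x \<in> I \<Longrightarrow> x \<in> above \<and> (\<forall>y\<in>I. x - y \<in> P \<longrightarrow> shortest x y \<in> P)"
proof (induction rule: ideal_induct)
  case theta
  have "pair y \<theta> = 1" if "y \<in> I" "\<theta> - y \<in> P" for y
    using that diff_root_iff[of \<theta> y] theta_root ideal_root pos_root pair_commute by metis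
  then show ?case using theta_above_and_positive by blast
next
  case (step x b)
  have bp: "b \<in> \<Delta>" "b \<in> P" using step simple_root simple_pos by auto
  have xr: "x \<in> \<Delta>" "x \<in> P" using step ideal_root ideal_pos by auto
  have ya: "x + b \<in> above" and IH: "\<And>y. y \<in> I \<Longrightarrow> x + b - y \<in> P \<Longrightarrow> shortest (x + b) y \<in> P"
    using step by auto
  \<comment> \<open>If \<open>\<alpha>\<close> were missing from \<open>x\<close>, the map for \<open>x + b\<close> would have to invert \<open>x\<close>.\<close>
  have xa: "x \<in> above"
  proof (rule ccontr)
    assume "x \<notin> above"
    then have c: "coef \<alpha> x = 0"
      using coef_pos_ge_1[OF xr(2) alpha] coef_nonneg[OF xr(2) alpha] xr(2)
      by (fastforce simp: above_def)
    have "- shortest (x + b) x \<in> P"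
      using shortest_inverts_off_support[OF ya xr(2) _ c] bp by simp
    moreover have "shortest (x + b) x \<in> P" using IH[of x] step bp by simp
    ultimately show False using not_pos_and_neg by blast
  qed
  have yb: "pair (x + b) b = 1" using step bp by simp
  have e: "shortest (x + b) = shortest x \<circ> refl b"
    using shortest_step[OF above_pos[OF ya] step(2) yb] xa by simp
  have "shortest x y \<in> P" if y: "y \<in> I" "x - y \<in> P" for y
  proof -
    have yr: "y \<in> \<Delta>" "y \<in> P" using y ideal_root ideal_pos by auto
    have xy: "x - y \<in> \<Delta>" using y pos_root by blast
    have e': "shortest x y = shortest (x + b) (refl b y)" using e bp by simp
    show ?thesis
    proof (cases rule: pair_cases[OF yr(1) bp(1)])
      case 1
      then have "pair x b = 1" using diff_root_iff xr bp xy by blast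
      then show ?thesis using step by simp
    next
      case 2
      then have "pair (x - y) b = - 2" using step by simp
      then have "x - y = - b" using pair_eq_minus_2 xy bp by blast
      then show ?thesis using y bp not_pos_and_neg by metis
    next
      case 3
      then have r: "refl b y = y" using bp by (simp add: refl_root)
      have "pair (x - y) b = - 1" using 3 step by simp
      then have "x - y + b \<in> P" using add_root_iff xy bp pos_add y by blast
      then have "x + b - y \<in> P" by (simp add: algebra_simps)
      then show ?thesis using e' r IH y by simp
    next
      case 4
      then have r: "refl b y = y + b" using bp by (simp add: refl_root)
      have "y + b \<in> I" using ideal_up add_root_iff 4 y yr bp by blast
      then show ?thesis using e' r IH[of "y + b"] y by simp
    next
      case 5
      then show ?thesis using yr bp not_pos_and_neg by metis
    qed
  qed
  then show ?case using xa by blast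
qed

text \<open>The positive roots that cannot be added to any root of \<open>I\<close> form an ideal: in
\<open>x + y + z \<in> \<Delta>\<close> with \<open>z \<in> I\<close>, the pairings force \<open>y + z\<close> to be a root, hence in \<open>I\<close>, and then
\<open>x + (y + z)\<close> is a forbidden sum. Going down from the highest such roots, each one can be adjoined
to \<open>I\<close> and so belongs to it.\<close>
lemma ideal_self_centralizing:
  assumes "x \<in> P" "\<And>y. y \<in> I \<Longrightarrow> x + y \<notin> \<Delta>" shows "x \<in> I"
  using assms
proof (induction "nat \<lfloor>height \<theta> - height x\<rfloor>" arbitrary: x rule: less_induct)
  case less
  note prems = less.prems
  have xr: "x \<in> \<Delta>" using prems pos_root by blast
  have up: "x + y \<in> I" if y: "y \<in> P" "x + y \<in> \<Delta>" for y
  proof (rule less.hyps)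
    have p: "x + y \<in> P" using pos_add prems y by blast
    have yr: "y \<in> \<Delta>" using y pos_root by blast
    have "height (x + y) \<le> height \<theta>"
      unfolding height_def using theta_ge y by (intro sum_mono) blast
    then show "nat \<lfloor>height \<theta> - height (x + y)\<rfloor> < nat \<lfloor>height \<theta> - height x\<rfloor>"
      using height_pos[OF y(1)] by (simp; linarith)
    show "x + y \<in> P" by fact
    show "x + y + z \<notin> \<Delta>" if z: "z \<in> I" for z
    proof
      assume s: "x + y + z \<in> \<Delta>"
      have zr: "z \<in> \<Delta>" "z \<in> P" using z ideal_root ideal_pos by auto
      have xyz: "pair x z + pair y z = - 1" using add_root_iff[OF y(2) zr(1)] s by simp
      have xy: "pair x y = - 1" using add_root_iff xr yr y by blast
      have xz: "pair x z \<noteq> - 1" using add_root_iff[OF xr zr(1)] prems(2) z by blast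
      have xz2: "pair x z \<noteq> - 2"
        using pair_eq_minus_2[OF xr zr(1)] not_pos_and_neg prems zr by metis
      have yz2: "pair y z \<noteq> - 2"
        using pair_eq_minus_2[OF yr zr(1)] not_pos_and_neg y zr by metis
      have xz0: "pair x z = 0 \<and> pair y z = - 1"
        using xyz xz xz2 yz2 pair_ge[OF yr zr(1)]
        by (cases rule: pair_cases[OF xr zr(1)]) auto
      then have "z + y \<in> I"
        using ideal_up add_root_iff[OF zr(1) yr] z y by (simp add: pair_commute)
      moreover have "x + (z + y) \<in> \<Delta>" using s by (simp add: algebra_simps)
      ultimately show False using prems(2) by blast
    qed
  qed
  have xx: "x + x \<notin> \<Delta>" using add_root_iff[OF xr xr] xr by simp
  have "comb_abelian_ideal \<Delta> B (insert x I)"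
    unfolding comb_abelian_ideal_def
    using prems ideal_pos ideal_up ideal_abelian up xx by (auto simp: add.commute)
  then show ?case by (rule maximal)
qed

text \<open>Composing with the reflection in \<open>\<alpha>\<close> changes the sign of \<open>\<plusminus> \<alpha>\<close> only, and \<open>\<alpha>\<close> is the image of \<open>x\<close>.\<close>
lemma inversions_w_tilde:
  assumes "x \<in> above"
  shows "y \<in> inversions \<Delta> B (w_tilde \<Delta> B \<alpha> x) \<longleftrightarrow> y \<in> P \<and> (y = x \<or> - shortest x y \<in> P)"
proof (cases "y \<in> P")
  case True
  have ap: "\<alpha> \<in> P" "\<alpha> \<in> \<Delta>" using alpha simple_pos alpha_root by auto
  have yr: "y \<in> \<Delta>" and r: "shortest x y \<in> \<Delta>" using True pos_root shortest_root assms by auto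
  have inj: "shortest x y = shortest x z \<Longrightarrow> pair y z = 2" if "z \<in> \<Delta>" for z
  proof -
    have "pair (shortest x y) (shortest x z) = pair y z" for y z
      using shortest_weyl[OF assms] unfolding weyl_def
      by (induction rule: gen_maps.induct) (auto simp: pair_refl)
    then show "shortest x y = shortest x z \<Longrightarrow> pair y z = 2" using r by (metis pair_self)
  qed
  have eq: "shortest x y = \<alpha> \<longleftrightarrow> y = x"
    using inj[OF above_root[OF assms]] shortest_apply[OF assms] pair_eq_2[OF yr above_root[OF assms]]
    by metis
  have ne: "shortest x y \<noteq> - \<alpha>"
  proof
    assume "shortest x y = - \<alpha>"
    then have "shortest x y = shortest x (- x)" using shortest_apply shortest_minus assms by simp
    then have "y = - x"
      using inj[of "- x"] neg_root above_root assms pair_eq_2 yr by blast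
    then show False using True assms above_pos not_pos_and_neg by metis
  qed
  have "- refl \<alpha> (shortest x y) \<in> P \<longleftrightarrow> shortest x y = \<alpha> \<or> - shortest x y \<in> P"
  proof
    assume *: "- refl \<alpha> (shortest x y) \<in> P"
    show "shortest x y = \<alpha> \<or> - shortest x y \<in> P"
    proof (rule ccontr)
      assume "\<not> ?thesis"
      then have "refl \<alpha> (shortest x y) \<in> P" using simple_refl_pos alpha r pos_or_neg by blast
      then show False using * not_pos_and_neg by blast
    qed
  next
    assume "shortest x y = \<alpha> \<or> - shortest x y \<in> P"
    then show "- refl \<alpha> (shortest x y) \<in> P"
    proof
      assume "- shortest x y \<in> P"
      moreover have "- shortest x y \<noteq> \<alpha>" using ne by (metis minus_minus)
      ultimately have "refl \<alpha> (- shortest x y) \<in> P" using simple_refl_pos alpha by blast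
      then show ?thesis by (simp add: refl_minus)
    qed (use ap in simp)
  qed
  then show ?thesis using True eq by (simp add: inv_iff w_tilde_def)
qed (simp add: inv_iff)

text \<open>An inverted \<open>y \<noteq> x\<close> pairs to 1 with \<open>x\<close>, so \<open>x - y\<close> is a root. If it is positive, \<open>y \<in> I\<close> is not
inverted; if it is negative, \<open>y - x\<close> would also be inverted although it pairs to -1 with \<open>x\<close>.\<close>
lemma ideal_inverted_once:
  assumes "x \<in> I" "y \<in> I"
  shows "y \<in> inversions \<Delta> B (w_tilde \<Delta> B \<alpha> x) \<longleftrightarrow> y = x"
proof -
  have xa: "x \<in> above" using ideal_above_and_positive assms by blast
  have "- shortest x y \<notin> P" if "y \<noteq> x"
  proof
    assume n: "- shortest x y \<in> P"
    then have "pair y x = 1" using shortest_inverted_pair xa ideal_pos assms by blast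
    then have "x - y \<in> \<Delta>" using diff_root_iff assms ideal_root by (simp add: pair_commute)
    then consider "x - y \<in> P" | "y - x \<in> P" using pos_or_neg by fastforce
    then show False
    proof cases
      case 1
      then show ?thesis using ideal_above_and_positive assms n not_pos_and_neg by blast
    next
      case 2
      have "shortest x (x - y) \<in> P"
        using shortest_complement n xa assms ideal_root \<open>x - y \<in> \<Delta>\<close> by blast
      then have "- shortest x (y - x) \<in> P"
        using shortest_minus[OF xa, of "x - y"] by simp
      then have "pair (y - x) x = 1" using shortest_inverted_pair xa 2 by blast
      then show ?thesis using \<open>pair y x = 1\<close> xa above_root by simp
    qed
  qed
  then show ?thesis using inversions_w_tilde[OF xa] ideal_pos assms by blast
qed

text \<open>A root \<open>y \<notin> I\<close> is one half of some \<open>y + z \<in> I\<close> whose other half \<open>z\<close> lies in \<open>I\<close> and is not inverted.\<close>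
lemma every_root_inverted:
  assumes "y \<in> P"
  shows "\<exists>x\<in>I. y \<in> inversions \<Delta> B (w_tilde \<Delta> B \<alpha> x)"
proof (cases "y \<in> I")
  case True
  then show ?thesis using ideal_inverted_once by blast
next
  case False
  then obtain z where z: "z \<in> I" "y + z \<in> \<Delta>" using ideal_self_centralizing assms by blast
  have x: "y + z \<in> I" using ideal_up[of z y] z assms by (simp add: add.commute)
  then have xa: "y + z \<in> above" using ideal_above_and_positive by blast
  have "shortest (y + z) z \<in> P" using ideal_above_and_positive[OF x] z assms by simp
  then have "- shortest (y + z) y \<in> P"
    using shortest_complement[OF xa, of y] z assms pos_root ideal_root by simp
  then show ?thesis using inversions_w_tilde[OF xa] assms x by blast
qed

theorem minimal_inversion_complete:
  defines "F \<equiv> w_tilde \<Delta> B \<alpha> ` I"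
  shows "min_inv_complete \<Delta> B F" "card F = card I" "I \<subseteq> Ess \<Delta> B F"
proof -
  have self: "x \<in> inversions \<Delta> B (w_tilde \<Delta> B \<alpha> x)" if "x \<in> I" for x
    using ideal_inverted_once that by blast
  show "card F = card I"
    unfolding F_def by (intro card_image inj_onI) (metis ideal_inverted_once)
  show "I \<subseteq> Ess \<Delta> B F"
    unfolding Ess_def F_def using ideal_pos ideal_inverted_once by blast
  have weyl: "F \<subseteq> weyl \<Delta>"
  proof -
    have "refl \<alpha> \<circ> shortest x \<in> weyl \<Delta>" if "x \<in> I" for x
      using shortest_weyl ideal_above_and_positive[OF that] alpha_root
      unfolding weyl_def by (intro gen_maps.gen_step) auto
    then show ?thesis by (auto simp: F_def w_tilde_def)
  qed
  have sub: "inversions \<Delta> B w \<subseteq> P" for w by (auto simp: inversions_def)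
  have cover: "(\<Union>w\<in>F. inversions \<Delta> B w) = P"
    using every_root_inverted sub unfolding F_def by blast
  have "(\<Union>w\<in>F'. inversions \<Delta> B w) \<noteq> P" if F': "F' \<subset> F" for F'
  proof -
    obtain x where x: "x \<in> I" "w_tilde \<Delta> B \<alpha> x \<notin> F'" using F' unfolding F_def by blast
    have "x \<notin> (\<Union>w\<in>F'. inversions \<Delta> B w)"
    proof
      assume "x \<in> (\<Union>w\<in>F'. inversions \<Delta> B w)"
      then obtain z where z: "z \<in> I" "w_tilde \<Delta> B \<alpha> z \<in> F'" "x \<in> inversions \<Delta> B (w_tilde \<Delta> B \<alpha> z)"
        using F' unfolding F_def by blast
      then show False using ideal_inverted_once x by blast
    qed
    then show ?thesis using ideal_pos x by blast
  qed
  then show "min_inv_complete \<Delta> B F"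
    unfolding min_inv_complete_def using weyl cover by blast
qed

end

section \<open>Weight spaces of the Lie algebra\<close>

context lie_algebra begin

lemma br_add_left: "br (x + y) z = br x z + br y z"
  and br_scale_left: "br (sc c x) z = sc c (br x z)"
  using br_linear_left[of z] by (simp_all add: Vector_Spaces.linear_iff)

lemma br_add_right: "br z (x + y) = br z x + br z y"
  and br_scale_right: "br z (sc c x) = sc c (br z x)"
  using br_linear_right[of z] by (simp_all add: Vector_Spaces.linear_iff)

lemma br_zero_left [simp]: "br 0 x = 0" and br_zero_right [simp]: "br x 0 = 0"
  using br_scale_left[of 0 0 x] br_scale_right[of x 0 0] by simp_all

lemma br_minus_left: "br (- x) z = - br x z" and br_minus_right: "br z (- x) = - br z x"
  using br_scale_left[of "- 1" x z] br_scale_right[of z "- 1" x] by simp_all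

lemma br_sum_left: "br (\<Sum>i\<in>A. f i) z = (\<Sum>i\<in>A. br (f i) z)"
  by (induction A rule: infinite_finite_induct) (auto simp: br_add_left)

lemma br_sum_right: "br z (\<Sum>i\<in>A. f i) = (\<Sum>i\<in>A. br z (f i))"
  by (induction A rule: infinite_finite_induct) (auto simp: br_add_right)

lemma br_anti: "br x y = - br y x"
proof -
  have "br (x + y) (x + y) = br x y + br y x"
    by (simp add: br_add_left br_add_right br_alternating del: br_alternating) (simp add: br_alternating)
  then show ?thesis by (simp add: br_alternating eq_neg_iff_add_eq_0)
qed

text \<open>The Jacobi identity in the form that \<open>br x\<close> is a derivation. With \<open>h = br e f\<close> it reads
\<open>e f z = h z + f e z\<close>, which is how it is used for root strings below.\<close>
lemma br_deriv: "br x (br y z) = br (br x y) z + br y (br x z)"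
proof -
  have "br x (br y z) + br y (br z x) + br z (br x y) = 0" by (rule jacobi)
  moreover have "br y (br z x) = - br y (br x z)" using br_anti[of z x] by (simp add: br_minus_right)
  moreover have "br z (br x y) = - br (br x y) z" by (rule br_anti)
  ultimately show ?thesis by (simp add: algebra_simps)
qed

end

locale ade_lie_algebra =
  simple_lie_algebra sc br + ade_root_system \<Delta> B \<theta>
  for sc :: "complex \<Rightarrow> 'g::ab_group_add \<Rightarrow> 'g" and br :: "'g \<Rightarrow> 'g \<Rightarrow> 'g"
    and \<Delta> B :: "'v::euclidean_space set" and \<theta> :: 'v +
  fixes H :: "'v \<Rightarrow> 'g"
  assumes triangular: "triangular_decomposition sc br H \<Delta> B"
begin

abbreviation rspace :: "'v \<Rightarrow> 'g set" where "rspace \<equiv> root_space sc br H"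
abbreviation T :: "'g set" where "T \<equiv> torus sc H"

lemma H_add: "H (u + v) = H u + H v"
  and H_scale: "H (r *\<^sub>R v) = sc (complex_of_real r) (H v)"
  and H_comm: "br (H u) (H v) = 0"
  and root_iff: "x \<in> \<Delta> \<longleftrightarrow> x \<noteq> 0 \<and> rspace x \<noteq> {0}"
  and decompose: "\<exists>x\<in>root_sum sc br H (uminus ` P). \<exists>h\<in>T. \<exists>y\<in>root_sum sc br H P. z = x + h + y"
proof -
  show "H (u + v) = H u + H v" "H (r *\<^sub>R v) = sc (complex_of_real r) (H v)" "br (H u) (H v) = 0"
    "\<exists>x\<in>root_sum sc br H (uminus ` P). \<exists>h\<in>T. \<exists>y\<in>root_sum sc br H P. z = x + h + y"
    using triangular unfolding triangular_decomposition_def by blast+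
  have "\<Delta> = {x. x \<noteq> 0 \<and> rspace x \<noteq> {0}}"
    using triangular unfolding triangular_decomposition_def by (elim conjE)
  then show "x \<in> \<Delta> \<longleftrightarrow> x \<noteq> 0 \<and> rspace x \<noteq> {0}" by (subst (asm) set_eq_iff) simp
qed

lemma H_zero [simp]: "H 0 = 0"
  using H_scale[of 0 0] by simp

lemma rspaceD: "x \<in> rspace a \<Longrightarrow> br (H v) x = sc (complex_of_real (a \<bullet> v)) x"
  by (simp add: root_space_def)

lemma subspace_rspace: "subspace (rspace a)"
  unfolding subspace_def root_space_def
  by (auto simp: br_add_right br_scale_right scale_right_distrib mult.commute)

lemmas rspace_zero [simp] = subspace_0[OF subspace_rspace]
  and rspace_scale = subspace_scale[OF subspace_rspace]
  and rspace_add = subspace_add[OF subspace_rspace]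
  and rspace_diff = subspace_diff[OF subspace_rspace]
  and rspace_minus = subspace_neg[OF subspace_rspace]

lemma rspace_br: "x \<in> rspace a \<Longrightarrow> y \<in> rspace b \<Longrightarrow> br x y \<in> rspace (a + b)"
  unfolding root_space_def
  by (auto simp: br_deriv[of "H _" x y] br_scale_left br_scale_right scale_left_distrib inner_add_left)

lemma rspace_non_root: "x \<in> rspace a \<Longrightarrow> a \<noteq> 0 \<Longrightarrow> a \<notin> \<Delta> \<Longrightarrow> x = 0"
  using root_iff[of a] by auto

text \<open>Every element of the torus has this form, which lets a real vector evaluate it through two real
inner products.\<close>
definition torus_elt :: "'v \<Rightarrow> 'v \<Rightarrow> 'g" where "torus_elt u v = H u + sc \<i> (H v)"
text \<open>The value on \<open>torus_elt u v\<close> of the complex linear functional given by \<open>a\<close>.\<close>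
definition weight :: "'v \<Rightarrow> 'v \<Rightarrow> 'v \<Rightarrow> complex" where "weight u v a = Complex (a \<bullet> u) (a \<bullet> v)"

lemma weight_add: "weight u v (a + b) = weight u v a + weight u v b"
  and weight_diff: "weight u v (a - b) = weight u v a - weight u v b"
  and weight_minus: "weight u v (- a) = - weight u v a"
  by (simp_all add: weight_def complex_eq_iff inner_add_left inner_diff_left)

lemma br_torus_elt: "x \<in> rspace a \<Longrightarrow> br (torus_elt u v) x = sc (weight u v a) x"
proof -
  assume x: "x \<in> rspace a"
  have "br (torus_elt u v) x = sc (complex_of_real (a \<bullet> u) + \<i> * complex_of_real (a \<bullet> v)) x"
    using x by (simp add: torus_elt_def br_add_left br_scale_left rspaceD scale_left_distrib)
  then show ?thesis by (simp add: weight_def Complex_eq)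
qed

lemma torus_elt_zero: "torus_elt 0 0 = 0" by (simp add: torus_elt_def)

lemma torus_torus_elt: "h \<in> T \<Longrightarrow> \<exists>u v. h = torus_elt u v"
proof -
  have "span (range H) \<subseteq> {h. \<exists>u v. h = torus_elt u v}"
  proof (rule span_minimal)
    have "H w = torus_elt w 0" for w by (simp add: torus_elt_def)
    then show "range H \<subseteq> {h. \<exists>u v. h = torus_elt u v}" by blast
    have add: "torus_elt u v + torus_elt u' v' = torus_elt (u + u') (v + v')" for u v u' v'
      by (simp add: torus_elt_def H_add scale_right_distrib algebra_simps)
    have scl: "sc c (torus_elt u v) = torus_elt (Re c *\<^sub>R u - Im c *\<^sub>R v) (Im c *\<^sub>R u + Re c *\<^sub>R v)" for c u v
    proof -
      have c: "c = complex_of_real (Re c) + \<i> * complex_of_real (Im c)" by (rule complex_eq)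
      have H_minus: "H (- w) = - H w" for w
        using H_scale[of "- 1" w] by simp
      have "sc c (torus_elt u v) = sc (Re c) (H u) + sc (\<i> * Im c) (H u) + (sc (\<i> * Re c) (H v) - sc (Im c) (H v))"
        by (subst c) (simp add: torus_elt_def scale_left_distrib scale_right_distrib scale_left_diff_distrib algebra_simps)
      also have "\<dots> = torus_elt (Re c *\<^sub>R u - Im c *\<^sub>R v) (Im c *\<^sub>R u + Re c *\<^sub>R v)"
        unfolding torus_elt_def using H_add[of "Re c *\<^sub>R u" "- (Im c *\<^sub>R v)"]
        by (simp add: H_add H_scale H_minus scale_right_distrib)
      finally show ?thesis .
    qed
    show "subspace {h. \<exists>u v. h = torus_elt u v}"
      unfolding subspace_def
      using torus_elt_zero add scl by (auto; metis)
  qed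
  then show "h \<in> T \<Longrightarrow> \<exists>u v. h = torus_elt u v" unfolding torus_def by blast
qed

lemma H_torus: "H v \<in> T" unfolding torus_def by (rule span_base) simp

lemma torus_rspace_zero: "T \<subseteq> rspace 0"
  unfolding torus_def
  by (rule span_minimal[OF _ subspace_rspace]) (auto simp: root_space_def H_comm)

text \<open>Induction on the number of weights: for \<open>a \<noteq> b\<close> some \<open>H v\<close> separates them, and applying
\<open>br (H v)\<close> minus the eigenvalue of \<open>b\<close> removes the \<open>b\<close>-component while rescaling the others.
With \<open>A = {0}\<close> this is the independence of the weight spaces.\<close>
lemma weight_projection:
  assumes "finite S" "subspace A" "\<And>v x. x \<in> A \<Longrightarrow> br (H v) x \<in> A"
    and "\<And>a. a \<in> S \<Longrightarrow> f a \<in> rspace a" "(\<Sum>a\<in>S. f a) \<in> A" "a \<in> S"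
  shows "f a \<in> A"
  using assms(1,4-)
proof (induction S arbitrary: f a rule: finite_induct)
  case (insert b S)
  note scA = subspace_scale[OF assms(2)] and diA = subspace_diff[OF assms(2)]
  have sub: "f a \<in> A" if a: "a \<in> S" for a
  proof -
    have "a \<noteq> b" using insert.hyps a by blast
    then obtain v where v: "a \<bullet> v \<noteq> b \<bullet> v"
      by (metis inner_diff_left inner_eq_zero_iff right_minus_eq)
    define g where "g c = sc (complex_of_real (c \<bullet> v) - complex_of_real (b \<bullet> v)) (f c)" for c
    have fr: "\<And>c. c \<in> insert b S \<Longrightarrow> f c \<in> rspace c" by fact
    have sum: "(\<Sum>c\<in>insert b S. f c) \<in> A" by fact
    have "br (H v) (\<Sum>c\<in>insert b S. f c) - sc (complex_of_real (b \<bullet> v)) (\<Sum>c\<in>insert b S. f c)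
        = (\<Sum>c\<in>insert b S. g c)"
      unfolding br_sum_right scale_sum_right sum_subtractf[symmetric]
      by (intro sum.cong refl) (simp add: g_def rspaceD[OF fr] scale_left_diff_distrib)
    also have "\<dots> = (\<Sum>c\<in>S. g c)" using insert.hyps by (simp add: g_def)
    finally have "(\<Sum>c\<in>S. g c) \<in> A"
      using diA[OF assms(3)[OF sum] scA[OF sum]] by metis
    moreover have "g c \<in> rspace c" if "c \<in> S" for c
      unfolding g_def using rspace_scale fr that by blast
    ultimately have "g a \<in> A" using insert.IH a by blast
    then have "sc (inverse (complex_of_real (a \<bullet> v) - complex_of_real (b \<bullet> v))) (g a) \<in> A"
      by (rule scA)
    moreover have "complex_of_real (a \<bullet> v) - complex_of_real (b \<bullet> v) \<noteq> 0"
      using v by simp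
    ultimately show ?thesis unfolding g_def by simp
  qed
  show ?case
  proof (cases "a = b")
    case True
    have "(\<Sum>c\<in>S. f c) \<in> A" using sub by (rule subspace_sum[OF assms(2)])
    then have "(\<Sum>c\<in>insert b S. f c) - (\<Sum>c\<in>S. f c) \<in> A" using diA insert.prems by blast
    then show ?thesis using True insert.hyps by simp
  next
    case False
    then show ?thesis using sub insert.prems by blast
  qed
qed simp

lemma weights_independent:
  assumes "finite S" "\<And>a. a \<in> S \<Longrightarrow> f a \<in> rspace a" "(\<Sum>a\<in>S. f a) = 0" "a \<in> S"
  shows "f a = 0"
  using weight_projection[of S "{0}" f a] assms by (auto simp: subspace_single_0)

lemma subspace_root_sum: "subspace (root_sum sc br H S)"
  unfolding root_sum_def by (rule subspace_span)

lemma rspace_root_sum: "a \<in> S \<Longrightarrow> x \<in> rspace a \<Longrightarrow> x \<in> root_sum sc br H S"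
  unfolding root_sum_def by (rule span_base) blast

lemma root_sum_iff:
  assumes "finite S"
  shows "z \<in> root_sum sc br H S \<longleftrightarrow> (\<exists>f. (\<forall>a\<in>S. f a \<in> rspace a) \<and> z = (\<Sum>a\<in>S. f a))"
proof
  let ?X = "{z. \<exists>f. (\<forall>a\<in>S. f a \<in> rspace a) \<and> z = (\<Sum>a\<in>S. f a)}"
  have "root_sum sc br H S \<subseteq> ?X"
    unfolding root_sum_def
  proof (rule span_minimal)
    show "(\<Union>a\<in>S. rspace a) \<subseteq> ?X"
    proof clarify
      fix a x assume a: "a \<in> S" "x \<in> rspace a"
      have "x = (\<Sum>b\<in>S. if b = a then x else 0)" using a assms by simp
      then show "\<exists>f. (\<forall>a\<in>S. f a \<in> rspace a) \<and> x = (\<Sum>a\<in>S. f a)"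
        using a by (intro exI[of _ "\<lambda>b. if b = a then x else 0"]) auto
    qed
    show "subspace ?X"
      unfolding subspace_def
    proof (intro conjI ballI allI)
      show "0 \<in> ?X" by (auto intro!: exI[of _ "\<lambda>_. 0"])
    next
      fix x y assume "x \<in> ?X" "y \<in> ?X"
      then obtain f g where "\<forall>a\<in>S. f a \<in> rspace a" "x = (\<Sum>a\<in>S. f a)"
        "\<forall>a\<in>S. g a \<in> rspace a" "y = (\<Sum>a\<in>S. g a)" by blast
      then show "x + y \<in> ?X"
        by (auto intro!: exI[of _ "\<lambda>a. f a + g a"] simp: rspace_add sum.distrib)
    next
      fix c x assume "x \<in> ?X"
      then obtain f where "\<forall>a\<in>S. f a \<in> rspace a" "x = (\<Sum>a\<in>S. f a)" by blast
      then show "sc c x \<in> ?X"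
        by (auto intro!: exI[of _ "\<lambda>a. sc c (f a)"] simp: rspace_scale scale_sum_right)
    qed
  qed
  then show "z \<in> root_sum sc br H S \<Longrightarrow> \<exists>f. (\<forall>a\<in>S. f a \<in> rspace a) \<and> z = (\<Sum>a\<in>S. f a)" by blast
next
  assume "\<exists>f. (\<forall>a\<in>S. f a \<in> rspace a) \<and> z = (\<Sum>a\<in>S. f a)"
  then show "z \<in> root_sum sc br H S"
    by (auto intro!: subspace_sum[OF subspace_root_sum] rspace_root_sum)
qed

lemma decompose_roots: "\<exists>h\<in>T. \<exists>f. (\<forall>a\<in>\<Delta>. f a \<in> rspace a) \<and> z = h + (\<Sum>a\<in>\<Delta>. f a)"
proof -
  have fin: "finite (uminus ` P)" using finite_pos by simp
  obtain x h y where z: "x \<in> root_sum sc br H (uminus ` P)" "h \<in> T" "y \<in> root_sum sc br H P" "z = x + h + y"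
    using decompose by blast
  obtain f where f: "\<forall>a\<in>uminus ` P. f a \<in> rspace a" "x = (\<Sum>a\<in>uminus ` P. f a)"
    using z(1) root_sum_iff[OF fin] by blast
  obtain g where g: "\<forall>a\<in>P. g a \<in> rspace a" "y = (\<Sum>a\<in>P. g a)"
    using z(3) root_sum_iff[OF finite_pos] by blast
  have D: "\<Delta> = uminus ` P \<union> P"
  proof (intro equalityI subsetI)
    fix a assume "a \<in> \<Delta>" then show "a \<in> uminus ` P \<union> P"
      using pos_or_neg by (metis UnCI image_eqI minus_minus)
  qed (use pos_root neg_root in auto)
  have disj: "uminus ` P \<inter> P = {}" using not_pos_and_neg by auto
  let ?k = "\<lambda>a. if a \<in> P then g a else f a"
  have "(\<Sum>a\<in>\<Delta>. ?k a) = (\<Sum>a\<in>uminus ` P \<union> P. ?k a)"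
    by (rule sum.cong[OF D HOL.refl])
  also have "\<dots> = (\<Sum>a\<in>uminus ` P. ?k a) + (\<Sum>a\<in>P. ?k a)"
    by (rule sum.union_disjoint[OF fin finite_pos disj])
  also have "(\<Sum>a\<in>uminus ` P. ?k a) = x"
    unfolding f(2) using disj by (intro sum.cong) auto
  also have "(\<Sum>a\<in>P. ?k a) = y"
    unfolding g(2) by (intro sum.cong) auto
  finally have "z = h + (\<Sum>a\<in>\<Delta>. ?k a)" using z(4) by (simp add: algebra_simps)
  moreover have "?k a \<in> rspace a" if "a \<in> \<Delta>" for a
  proof (cases "a \<in> P")
    case False
    then have "a \<in> uminus ` P" using D that by blast
    with f(1) have "f a \<in> rspace a" by (rule bspec)
    then show ?thesis using False by simp
  qed (use g(1) in simp)
  ultimately show ?thesis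
    by (intro bexI[OF _ z(2)] exI[of _ ?k]) blast
qed

text \<open>The torus is its own centralizer, because the nonzero weights of the triangular decomposition are
independent of the weight 0.\<close>
lemma rspace_zero_torus: "rspace 0 = T"
proof (intro equalityI subsetI)
  fix z assume z: "z \<in> rspace 0"
  obtain h f where h: "h \<in> T" "\<forall>a\<in>\<Delta>. f a \<in> rspace a" "z = h + (\<Sum>a\<in>\<Delta>. f a)"
    using decompose_roots by blast
  define g where "g = (\<lambda>a. if a = 0 then h - z else f a)"
  have gs: "(\<Sum>a\<in>insert 0 \<Delta>. g a) = 0"
  proof -
    have "(\<Sum>a\<in>\<Delta>. g a) = (\<Sum>a\<in>\<Delta>. f a)"
      using zero_not_root by (intro sum.cong) (auto simp: g_def)
    then show ?thesis using finite_roots zero_not_root h(3) by (simp add: g_def)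
  qed
  have "g 0 = 0"
  proof (rule weights_independent[OF _ _ gs])
    show "finite (insert 0 \<Delta>)" using finite_roots by simp
    show "g a \<in> rspace a" if "a \<in> insert 0 \<Delta>" for a
      using that h(1,2) z torus_rspace_zero rspace_diff by (auto simp: g_def)
  qed simp
  then show "z \<in> T" using h(1) by (simp add: g_def)
qed (use torus_rspace_zero in blast)

lemma torus_faithful:
  assumes "h \<in> T" "\<And>a x. a \<in> P \<Longrightarrow> x \<in> rspace a \<Longrightarrow> br h x = 0" shows "h = 0"
proof -
  obtain u v where h: "h = torus_elt u v" using torus_torus_elt assms by blast
  have "weight u v b = 0" if b: "b \<in> B" for b
  proof -
    obtain x where x: "x \<in> rspace b" "x \<noteq> 0" using root_iff[of b] simple_root[OF b] rspace_zero by blast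
    then have "sc (weight u v b) x = 0" using assms(2)[OF simple_pos[OF b] x(1)] br_torus_elt h by simp
    then show ?thesis using x by simp
  qed
  then have "b \<bullet> u = 0" "b \<bullet> v = 0" if "b \<in> B" for b
    using that by (auto simp: weight_def complex_eq_iff)
  then have "u = 0" "v = 0" using orthogonal_to_simple by blast+
  then show ?thesis using h torus_elt_zero by simp
qed

section \<open>Root spaces are lines\<close>

text \<open>Up to scaling, \<open>e\<close>, \<open>f\<close> and \<open>br e f\<close> form an \<open>sl\<^sub>2\<close>-triple.\<close>
definition sl2_root :: "'v \<Rightarrow> bool" where
  "sl2_root a \<longleftrightarrow> (\<exists>e\<in>rspace a. \<exists>f\<in>rspace (- a). br (br e f) e \<noteq> 0)"

lemma coroot:
  assumes "e \<in> rspace a" "f \<in> rspace (- a)"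
  obtains u v where "br e f = torus_elt u v"
proof -
  have "br e f \<in> T" using rspace_br[OF assms] rspace_zero_torus by simp
  then show thesis using torus_torus_elt that by blast
qed

text \<open>As \<open>a + a\<close> is not a root, \<open>e x = 0\<close>. Hence \<open>e f x = h x\<close> is a nonzero multiple of \<open>x\<close>, while \<open>f x\<close> is in
the torus and so \<open>e f x\<close> is a multiple of \<open>e\<close>.\<close>
lemma sl2_root_line:
  assumes "a \<in> \<Delta>" "e \<in> rspace a" "f \<in> rspace (- a)" "br (br e f) e \<noteq> 0" "x \<in> rspace a"
  shows "\<exists>c. x = sc c e"
proof -
  obtain u v where h: "br e f = torus_elt u v" using coroot assms by blast
  have c: "weight u v a \<noteq> 0" using assms(4) br_torus_elt[OF assms(2)] h by auto
  have "br f x \<in> rspace 0" using rspace_br[OF assms(3,5)] by simp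
  then obtain u' v' where k: "br f x = torus_elt u' v'" using rspace_zero_torus torus_torus_elt by blast
  have "a + a \<notin> \<Delta>" using add_root_iff[OF assms(1,1)] assms(1) by simp
  moreover have "a + a \<noteq> 0"
    using assms(1) zero_not_root by (metis scaleR_2 scaleR_eq_0_iff zero_neq_numeral)
  ultimately have ex: "br e x = 0" using rspace_non_root rspace_br assms by blast
  have "sc (weight u v a) x = br e (br f x)"
    using br_deriv[of e f x] ex h br_torus_elt[OF assms(5)] by simp
  also have "\<dots> = - br (br f x) e" by (rule br_anti)
  also have "\<dots> = sc (- weight u' v' a) e" using k br_torus_elt[OF assms(2)] by simp
  finally have "sc (inverse (weight u v a)) (sc (weight u v a) x) = sc (inverse (weight u v a)) (sc (- weight u' v' a) e)"
    by simp
  then have "x = sc (inverse (weight u v a) * - weight u' v' a) e"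
    using c by (simp del: mult_minus_right)
  then show ?thesis by blast
qed

text \<open>If \<open>h = br e f\<close> acted by a nonzero scalar \<open>c\<close> on some root space, it would do so along the whole
\<open>a\<close>-string, since \<open>a\<close> vanishes on \<open>h\<close>. But \<open>e f\<close> and \<open>f e\<close> have the same trace on a finite string, so
\<open>h = e f - f e\<close> has trace 0; as the string has at most two members, this is checked on a single
vector. So all roots vanish on \<open>h\<close>, and \<open>h = 0\<close>.\<close>
lemma degenerate_root_commute:
  assumes a: "a \<in> \<Delta>" "\<not> sl2_root a" and e: "e \<in> rspace a" and f: "f \<in> rspace (- a)"
  shows "br e f = 0"
proof (cases "e = 0")
  case False
  obtain u v where h: "br e f = torus_elt u v" using coroot e f by blast
  have "sc (weight u v a) e = 0" using a(2) e f br_torus_elt[OF e] h unfolding sl2_root_def by metis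
  then have c0: "weight u v a = 0" using False by simp
  \<comment> \<open>A root pairing to 1 with \<open>a\<close> is reduced to this case by subtracting \<open>a\<close>.\<close>
  have key: "weight u v b = 0" if b: "b \<in> \<Delta>" "pair b a = 0 \<or> pair b a = - 1" for b
  proof (rule ccontr)
    assume c: "weight u v b \<noteq> 0"
    obtain x where x: "x \<in> rspace b" "x \<noteq> 0" using root_iff[of b] b rspace_zero by blast
    have ba: "b \<noteq> a" "b \<noteq> - a" using b(2) a(1) by auto
    have "b - a \<notin> \<Delta>" using diff_root_iff[OF b(1) a(1)] b(2) by auto
    then have fx: "br f x = 0"
      using rspace_br[OF f x(1)] ba rspace_non_root[of "br f x" "b - a"] by simp
    then have "br f (br e x) + sc (weight u v b) x = 0"
      using br_deriv[of e f x] br_torus_elt[OF x(1)] h by (simp add: add.commute)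
    then have hx: "- br f (br e x) = sc (weight u v b) x" by (rule minus_unique)
    have y: "br e x \<in> rspace (b + a)" using rspace_br[OF e x(1)] by (simp add: add.commute)
    have ne: "br e x \<noteq> 0" using hx c x by auto
    have "pair (b + a) a \<noteq> - 1" using b(2) a(1) by auto
    have bar: "b + a \<in> \<Delta>"
      using ne rspace_non_root[OF y] ba by (metis add_eq_0_iff2)
    then have "b + a + a \<notin> \<Delta>" using add_root_iff[OF bar a(1)] \<open>pair (b + a) a \<noteq> - 1\<close> by blast
    moreover have "b + a + a \<noteq> 0"
    proof
      assume "b + a + a = 0"
      then have "pair (b + a + a) a = 0" by simp
      then show False using b(2) a(1) by auto
    qed
    moreover have "br e (br e x) \<in> rspace (b + a + a)"
      using rspace_br[OF e y] by (simp add: algebra_simps)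
    ultimately have "br e (br e x) = 0" using rspace_non_root by blast
    then have "br e (br f (br e x)) = sc (weight u v b) (br e x)"
      using br_deriv[of e f "br e x"] br_torus_elt[OF y] h c0 by (simp add: weight_add)
    moreover have "br e (br f (br e x)) = - sc (weight u v b) (br e x)"
    proof -
      have "br f (br e x) = - sc (weight u v b) x" using hx by (metis minus_minus)
      then show ?thesis by (simp add: br_minus_right br_scale_right)
    qed
    ultimately have "sc (weight u v b + weight u v b) (br e x) = 0"
      by (metis (no_types, lifting) add.right_inverse scale_left_distrib)
    then show False using ne c by simp
  qed
  have "weight u v b = 0" if b: "b \<in> \<Delta>" for b
  proof (cases rule: pair_cases[OF b a(1)])
    case 2
    have "b - a \<in> \<Delta>" using diff_root_iff 2 b a by blast
    moreover have "pair (b - a) a = - 1" using 2 a by simp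
    ultimately have "weight u v (b - a) = 0" using key by blast
    then show ?thesis using c0 by (simp add: weight_diff)
  qed (use c0 key b in \<open>auto simp: weight_minus\<close>)
  then have "br (br e f) x = 0" if "x \<in> rspace b" "b \<in> P" for b x
    using br_torus_elt[OF that(1)] h that pos_root by simp
  then show ?thesis using torus_faithful rspace_br[OF e f] rspace_zero_torus by simp
qed simp

text \<open>The \<open>sl\<^sub>2\<close>-triple of \<open>a\<close> identifies the root spaces of \<open>b\<close> and \<open>a + b\<close>, and likewise of the negatives.
Under this identification the vanishing bracket for \<open>b\<close> becomes the one for \<open>a + b\<close>.\<close>
lemma degenerate_string:
  assumes a: "a \<in> \<Delta>" "sl2_root a" and b: "b \<in> \<Delta>" "\<not> sl2_root b" and ab: "a + b \<in> \<Delta>"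
  shows "\<not> sl2_root (a + b)"
proof -
  obtain e f where ef: "e \<in> rspace a" "f \<in> rspace (- a)" "br (br e f) e \<noteq> 0"
    using a(2) sl2_root_def by blast
  note e = ef(1) and f = ef(2)
  obtain u v where h: "br e f = torus_elt u v" using coroot e f by blast
  have ca: "weight u v a \<noteq> 0" using ef(3) br_torus_elt[OF e] h by auto
  have p: "pair a b = - 1" using add_root_iff a b ab by blast
  have n1: "b - a \<notin> \<Delta>" "b - a \<noteq> 0" "a - b \<notin> \<Delta>" "a - b \<noteq> 0"
    using p diff_root_iff[OF a(1) b(1)] diff_root_iff[OF b(1) a(1)] a(1)
    by (auto simp: pair_commute[of b a])
  have n2: "a + b + a \<notin> \<Delta>" "a + b + a \<noteq> 0"
  proof -
    have "pair (a + b) a = 1" using p a(1) by (simp add: pair_commute[of b a])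
    then show "a + b + a \<notin> \<Delta>" using add_root_iff[OF ab a(1)] by simp
    show "a + b + a \<noteq> 0"
    proof
      assume "a + b + a = 0"
      then have "pair (a + b + a) a = 0" by simp
      then show False using \<open>pair (a + b) a = 1\<close> a(1) by simp
    qed
  qed
  have eq: "- (a + b) - a = - (a + b + a)" by simp
  have n3: "- (a + b) - a \<notin> \<Delta>" "- (a + b) - a \<noteq> 0"
    unfolding eq using n2 neg_root[of "- (a + b + a)"] by (metis minus_minus, metis neg_equal_0_iff_equal)
  \<comment> \<open>If \<open>a + b\<close> vanished on \<open>h\<close>, then \<open>b\<close> would not, and \<open>e x = 0\<close> would follow for a root vector \<open>x\<close> of \<open>b\<close>, contradicting \<open>f e x = - h x\<close>.\<close>
  have cab: "weight u v (a + b) \<noteq> 0"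
  proof
    assume c0: "weight u v (a + b) = 0"
    then have cb: "weight u v b \<noteq> 0" using ca by (auto simp: weight_add)
    obtain x where x: "x \<in> rspace b" "x \<noteq> 0" using root_iff[of b] b rspace_zero by blast
    have y: "br e x \<in> rspace (a + b)" using rspace_br[OF e x(1)] .
    have "br f x = 0" using rspace_br[OF f x(1)] n1 rspace_non_root[of "br f x" "b - a"] by simp
    then have "sc (weight u v b) x + br f (br e x) = 0"
      using br_deriv[of e f x] br_torus_elt[OF x(1)] h by simp
    then have fy: "br f (br e x) = - sc (weight u v b) x" by (rule minus_unique[symmetric])
    have "br e (br e x) = 0"
      using rspace_br[OF e y] n2 rspace_non_root[of "br e (br e x)" "a + b + a"] by (simp add: algebra_simps)
    then have "br e (br f (br e x)) = 0"
      using br_deriv[of e f "br e x"] br_torus_elt[OF y] h c0 by simp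
    then have "sc (weight u v b) (br e x) = 0" unfolding fy by (simp add: br_minus_right br_scale_right)
    then have "br e x = 0" using cb by simp
    then show False using fy x cb by simp
  qed
  have "br p q = 0" if pq: "p \<in> rspace (a + b)" "q \<in> rspace (- (a + b))" for p q
  proof -
    have x: "br f p \<in> rspace b" using rspace_br[OF f pq(1)] by simp
    have y: "br e q \<in> rspace (- b)" using rspace_br[OF e pq(2)] by simp
    have "br e p = 0" using rspace_br[OF e pq(1)] n2 rspace_non_root[of "br e p" "a + b + a"] by (simp add: algebra_simps)
    then have ep: "br e (br f p) = sc (weight u v (a + b)) p"
      using br_deriv[of e f p] br_torus_elt[OF pq(1)] h by simp
    have "br f q = 0"
      using rspace_br[OF f pq(2)] n3 rspace_non_root[of "br f q" "- (a + b) - a"] by (simp add: algebra_simps)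
    then have "sc (weight u v (- (a + b))) q + br f (br e q) = 0"
      using br_deriv[of e f q] br_torus_elt[OF pq(2)] h by simp
    then have "br f (br e q) = - sc (weight u v (- (a + b))) q" by (rule minus_unique[symmetric])
    then have fq: "br f (br e q) = sc (weight u v (a + b)) q" unfolding weight_minus by simp
    let ?x = "br f p" and ?y = "br e q"
    have xy: "br ?x ?y = 0" by (rule degenerate_root_commute[OF b x y])
    have "br ?x f = 0"
      using rspace_br[OF x f] n1 rspace_non_root[of "br ?x f" "b - a"] by simp
    then have 1: "br ?x (br f ?y) = 0"
      using br_deriv[of ?x f ?y] xy by simp
    have "br e ?y = 0"
      using rspace_br[OF e y] n1 rspace_non_root[of "br e ?y" "a - b"] by simp
    then have "br e (br f ?y) = sc (weight u v (- b)) ?y"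
      using br_deriv[of e f ?y] br_torus_elt[OF y] h by simp
    then have 2: "br ?x (br e (br f ?y)) = 0" using xy by (simp add: br_scale_right)
    have "br e (br ?x (br f ?y)) = br (br e ?x) (br f ?y) + br ?x (br e (br f ?y))"
      by (rule br_deriv)
    then have "br (br e ?x) (br f ?y) = 0" using 1 2 by simp
    then show ?thesis unfolding ep fq using cab by (simp add: br_scale_left br_scale_right)
  qed
  then show ?thesis unfolding sl2_root_def by (metis br_zero_left)
qed

text \<open>The bracket is a multiple of \<open>e\<close>, yet \<open>f\<close> kills it: by the derivation rule \<open>f\<close> turns it into brackets
between opposite root spaces of \<open>a\<close> and of \<open>b\<close>.\<close>
lemma degenerate_bracket_zero:
  assumes "a \<in> \<Delta>" "\<not> sl2_root a" "b \<in> \<Delta>" "\<not> sl2_root b" "a + b \<in> \<Delta>" "sl2_root (a + b)"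
    and x: "x \<in> rspace a" and y: "y \<in> rspace b"
  shows "br x y = 0"
proof -
  obtain e f where ef: "e \<in> rspace (a + b)" "f \<in> rspace (- (a + b))" "br (br e f) e \<noteq> 0"
    using assms(6) sl2_root_def by blast
  obtain c where c: "br x y = sc c e" using sl2_root_line[OF assms(5) ef] rspace_br[OF x y] by blast
  have "br f x \<in> rspace (- b)" using rspace_br[OF ef(2) x] by simp
  then have 1: "br (br f x) y = 0"
    using degenerate_root_commute[OF assms(3,4) y] br_anti[of "br f x" y] by simp
  have "br f y \<in> rspace (- a)" using rspace_br[OF ef(2) y] by simp
  then have 2: "br x (br f y) = 0"
    using degenerate_root_commute[OF assms(1,2) x] by simp
  have "br f (br x y) = 0" using br_deriv[of f x y] 1 2 by simp
  then have "sc c (br f e) = 0" using c by (simp add: br_scale_right)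
  moreover have "br f e \<noteq> 0" using ef(3) br_anti[of e f] by auto
  ultimately show ?thesis using c by simp
qed

text \<open>The root spaces of the remaining roots span an ideal. It is zero or everything by simplicity; it
cannot be everything, because it is independent of the torus, and the torus is nonzero.\<close>
lemma all_roots_sl2: "a \<in> \<Delta> \<Longrightarrow> sl2_root a"
proof (rule ccontr)
  assume a: "a \<in> \<Delta>" "\<not> sl2_root a"
  define S where "S = {a \<in> \<Delta>. \<not> sl2_root a}"
  let ?N = "root_sum sc br H S"
  have finS: "finite S" using finite_roots by (simp add: S_def)
  have rspace_ideal: "br x y \<in> ?N" if b: "b \<in> S" "y \<in> rspace b" and c: "c \<in> \<Delta>" "x \<in> rspace c" for b c x y
  proof -
    have xy: "br x y \<in> rspace (c + b)" by (rule rspace_br[OF c(2) b(2)])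
    have bb: "b \<in> \<Delta>" "\<not> sl2_root b" using b by (auto simp: S_def)
    consider "c = - b" | "c + b \<noteq> 0" "c + b \<notin> \<Delta>" | "c + b \<in> S" | "c + b \<in> \<Delta>" "sl2_root (c + b)"
      by (auto simp: S_def add_eq_0_iff2)
    then show ?thesis
    proof cases
      case 1
      then have "br y x = 0" using degenerate_root_commute[OF bb b(2)] c by simp
      then show ?thesis using br_anti[of x y] subspace_0[OF subspace_root_sum] by simp
    next
      case 2
      then show ?thesis using rspace_non_root[OF xy] subspace_0[OF subspace_root_sum] by simp
    next
      case 3
      then show ?thesis using rspace_root_sum xy by blast
    next
      case 4
      then have "\<not> sl2_root c" using degenerate_string[OF c(1) _ bb] by blast
      then show ?thesis using degenerate_bracket_zero[OF c(1) _ bb 4 c(2) b(2)] subspace_0[OF subspace_root_sum] by simp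
    qed
  qed
  have closed: "br z y \<in> ?N" if y: "y \<in> ?N" for z y
  proof -
    obtain g where g: "\<forall>b\<in>S. g b \<in> rspace b" "y = (\<Sum>b\<in>S. g b)" using y root_sum_iff[OF finS] by blast
    obtain h f where h: "h \<in> T" "\<forall>c\<in>\<Delta>. f c \<in> rspace c" "z = h + (\<Sum>c\<in>\<Delta>. f c)"
      using decompose_roots by blast
    obtain u v where hu: "h = torus_elt u v" using torus_torus_elt h by blast
    have "br z (g b) \<in> ?N" if b: "b \<in> S" for b
    proof -
      have "br z (g b) = sc (weight u v b) (g b) + (\<Sum>c\<in>\<Delta>. br (f c) (g b))"
        using h(3) hu br_torus_elt g(1) b by (simp add: br_add_left br_sum_left)
      moreover have "sc (weight u v b) (g b) \<in> ?N" using rspace_root_sum rspace_scale g(1) b by blast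
      moreover have "(\<Sum>c\<in>\<Delta>. br (f c) (g b)) \<in> ?N"
        using rspace_ideal b g(1) h(2) by (intro subspace_sum[OF subspace_root_sum]) blast
      ultimately show ?thesis using subspace_add[OF subspace_root_sum] by simp
    qed
    then show ?thesis unfolding g(2) br_sum_right by (intro subspace_sum[OF subspace_root_sum])
  qed
  have "?N = {0} \<or> ?N = UNIV" by (rule no_ideals[OF subspace_root_sum closed])
  then show False
  proof
    assume 1: "?N = {0}"
    obtain x where x: "x \<in> rspace a" "x \<noteq> 0" using root_iff[of a] a rspace_zero by blast
    moreover have "a \<in> S" using a by (simp add: S_def)
    ultimately show False using rspace_root_sum[of a S x] 1 by simp
  next
    assume 2: "?N = UNIV"
    have "h = 0" if h: "h \<in> T" for h
    proof -
      obtain g where g: "\<forall>b\<in>S. g b \<in> rspace b" "h = (\<Sum>b\<in>S. g b)" using 2 root_sum_iff[OF finS] by blast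
      have z: "0 \<notin> S" using zero_not_root by (simp add: S_def)
      define k where "k = (\<lambda>a. if a = 0 then - h else g a)"
      have "(\<Sum>b\<in>S. k b) = h" unfolding g(2) using z by (intro sum.cong) (auto simp: k_def)
      then have ks: "(\<Sum>b\<in>insert 0 S. k b) = 0" using finS z by (simp add: k_def)
      have "k 0 = 0"
      proof (rule weights_independent[OF _ _ ks])
        show "finite (insert 0 S)" using finS by simp
        show "k b \<in> rspace b" if "b \<in> insert 0 S" for b
          using that g(1) h torus_rspace_zero rspace_minus by (auto simp: k_def)
      qed simp
      then show ?thesis by (simp add: k_def)
    qed
    then have H0: "H v = 0" for v using H_torus by blast
    obtain x where x: "x \<in> rspace a" "x \<noteq> 0" using root_iff[of a] a rspace_zero by blast
    have "sc (complex_of_real (a \<bullet> a)) x = 0" using rspaceD[OF x(1), of a] H0 by simp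
    then show ?thesis using x a zero_not_root by auto
  qed
qed

lemma root_vector:
  assumes "a \<in> \<Delta>"
  obtains e where "e \<in> rspace a" "e \<noteq> 0" "\<And>x. x \<in> rspace a \<Longrightarrow> \<exists>c. x = sc c e"
proof -
  obtain e f where ef: "e \<in> rspace a" "f \<in> rspace (- a)" "br (br e f) e \<noteq> 0"
    using all_roots_sl2[OF assms] sl2_root_def by blast
  then have "e \<noteq> 0" by auto
  then show thesis using that ef sl2_root_line[OF assms ef] by blast
qed

section \<open>Abelian ideals of the Borel subalgebra\<close>

abbreviation borel where "borel \<equiv> borel_subalg sc br H \<Delta> B"

lemma borel_iff: "z \<in> borel \<longleftrightarrow> (\<exists>h\<in>T. \<exists>f. (\<forall>a\<in>P. f a \<in> rspace a) \<and> z = h + (\<Sum>a\<in>P. f a))"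
proof
  assume "z \<in> borel"
  then obtain h y where z: "h \<in> T" "y \<in> root_sum sc br H P" "z = h + y"
    unfolding borel_subalg_def by blast
  then obtain f where "\<forall>a\<in>P. f a \<in> rspace a" "y = (\<Sum>a\<in>P. f a)"
    using root_sum_iff[OF finite_pos, THEN iffD1] by blast
  then show "\<exists>h\<in>T. \<exists>f. (\<forall>a\<in>P. f a \<in> rspace a) \<and> z = h + (\<Sum>a\<in>P. f a)"
    using z by blast
next
  assume "\<exists>h\<in>T. \<exists>f. (\<forall>a\<in>P. f a \<in> rspace a) \<and> z = h + (\<Sum>a\<in>P. f a)"
  then obtain h f where "h \<in> T" "\<forall>a\<in>P. f a \<in> rspace a" "z = h + (\<Sum>a\<in>P. f a)" by blast
  moreover from this(2) have "(\<Sum>a\<in>P. f a) \<in> root_sum sc br H P"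
    by (auto intro!: subspace_sum[OF subspace_root_sum] rspace_root_sum)
  ultimately show "z \<in> borel" unfolding borel_subalg_def by blast
qed

lemma torus_borel: "h \<in> T \<Longrightarrow> h \<in> borel"
  unfolding borel_iff by (intro bexI[of _ h] exI[of _ "\<lambda>_. 0"]) auto

lemma zero_torus: "0 \<in> T"
  using H_torus[of 0] by simp

lemma root_sum_borel: "S \<subseteq> P \<Longrightarrow> root_sum sc br H S \<subseteq> borel"
proof -
  assume "S \<subseteq> P"
  then have "root_sum sc br H S \<subseteq> root_sum sc br H P"
    unfolding root_sum_def by (intro span_mono) blast
  then show ?thesis unfolding borel_subalg_def using zero_torus by force
qed

lemma rspace_borel: "a \<in> P \<Longrightarrow> x \<in> rspace a \<Longrightarrow> x \<in> borel"
  using root_sum_borel[of P] rspace_root_sum by blast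

lemma abelian_ideal_root_sum:
  assumes I: "comb_abelian_ideal \<Delta> B I"
  shows "abelian_ideal sc br borel (root_sum sc br H I)"
proof -
  let ?N = "root_sum sc br H I"
  have IP: "I \<subseteq> P" using I by (simp add: comb_abelian_ideal_def)
  have finI: "finite I" using IP finite_pos finite_subset by blast
  have 0: "0 \<in> ?N" by (rule subspace_0[OF subspace_root_sum])
  have "br z y \<in> ?N" if z: "z \<in> borel" and y: "y \<in> ?N" for z y
  proof -
    obtain g where g: "\<forall>b\<in>I. g b \<in> rspace b" "y = (\<Sum>b\<in>I. g b)" using y root_sum_iff[OF finI] by blast
    obtain h f where h: "h \<in> T" "\<forall>c\<in>P. f c \<in> rspace c" "z = h + (\<Sum>c\<in>P. f c)"
      using z borel_iff by blast
    obtain u v where hu: "h = torus_elt u v" using torus_torus_elt h by blast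
    have "br z (g b) \<in> ?N" if b: "b \<in> I" for b
    proof -
      have gb: "g b \<in> rspace b" using g b by blast
      have "br (f c) (g b) \<in> ?N" if c: "c \<in> P" for c
      proof -
        have r: "br (f c) (g b) \<in> rspace (c + b)" using rspace_br h(2) c gb by blast
        show ?thesis
        proof (cases "c + b \<in> \<Delta>")
          case True
          then have "b + c \<in> I" using I b c unfolding comb_abelian_ideal_def by (metis add.commute)
          then show ?thesis using rspace_root_sum r by (metis add.commute)
        next
          case False
          moreover have "c + b \<noteq> 0" using pos_add_ne_zero c b IP by blast
          ultimately show ?thesis using rspace_non_root[OF r] 0 by simp
        qed
      qed
      moreover have "br z (g b) = sc (weight u v b) (g b) + (\<Sum>c\<in>P. br (f c) (g b))"
        using h(3) hu br_torus_elt[OF gb] by (simp add: br_add_left br_sum_left)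
      moreover have "sc (weight u v b) (g b) \<in> ?N" using rspace_root_sum rspace_scale gb b by blast
      ultimately show ?thesis
        by (simp add: subspace_add[OF subspace_root_sum] subspace_sum[OF subspace_root_sum])
    qed
    then show ?thesis unfolding g(2) br_sum_right by (intro subspace_sum[OF subspace_root_sum])
  qed
  moreover have "br x y = 0" if x: "x \<in> ?N" and y: "y \<in> ?N" for x y
  proof -
    obtain f where f: "\<forall>b\<in>I. f b \<in> rspace b" "x = (\<Sum>b\<in>I. f b)" using x root_sum_iff[OF finI] by blast
    obtain g where g: "\<forall>b\<in>I. g b \<in> rspace b" "y = (\<Sum>b\<in>I. g b)" using y root_sum_iff[OF finI] by blast
    have "br (f c) (g b) = 0" if "c \<in> I" "b \<in> I" for b c
    proof (rule rspace_non_root)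
      show "br (f c) (g b) \<in> rspace (c + b)" using rspace_br f g that by blast
      show "c + b \<noteq> 0" using pos_add_ne_zero that IP by blast
      show "c + b \<notin> \<Delta>" using I that by (simp add: comb_abelian_ideal_def)
    qed
    then show ?thesis unfolding f(2) g(2) br_sum_right br_sum_left by simp
  qed
  ultimately show ?thesis
    unfolding abelian_ideal_def using subspace_root_sum root_sum_borel[OF IP] by blast
qed

text \<open>An abelian ideal is stable under the torus, so it contains the weight components of its elements.
A torus component \<open>h\<close> vanishes: \<open>br h x\<close> is again in the ideal, so \<open>h\<close> acts on each root space by a
scalar of square zero. A nonzero component in a root space generates it, root spaces being lines.\<close>
lemma abelian_ideal_in_root_sum:
  assumes "abelian_ideal sc br borel A"
  shows "A \<subseteq> root_sum sc br H (ideal_roots sc br H \<Delta> B A)"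
proof
  fix z assume z: "z \<in> A"
  have A: "subspace A" "A \<subseteq> borel" "\<And>x y. x \<in> borel \<Longrightarrow> y \<in> A \<Longrightarrow> br x y \<in> A"
      "\<And>x y. x \<in> A \<Longrightarrow> y \<in> A \<Longrightarrow> br x y = 0"
    using assms unfolding abelian_ideal_def by blast+
  obtain h f where h: "h \<in> T" "\<forall>c\<in>P. f c \<in> rspace c" "z = h + (\<Sum>c\<in>P. f c)"
    using z A(2) borel_iff by blast
  define k where "k = (\<lambda>a. if a = 0 then h else f a)"
  have z0: "0 \<notin> P" using zero_not_root pos_root by blast
  have "(\<Sum>b\<in>P. k b) = (\<Sum>c\<in>P. f c)" using z0 by (intro sum.cong) (auto simp: k_def)
  then have ks: "(\<Sum>b\<in>insert 0 P. k b) \<in> A" using finite_pos z0 z h(3) by (simp add: k_def)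
  have kA: "k a \<in> A" if "a \<in> insert 0 P" for a
  proof (rule weight_projection[OF _ A(1) _ _ ks that])
    show "finite (insert 0 P)" using finite_pos by simp
    show "br (H v) x \<in> A" if "x \<in> A" for v x using A(3) torus_borel H_torus that by blast
    show "k b \<in> rspace b" if "b \<in> insert 0 P" for b
      using that h(1,2) torus_rspace_zero by (auto simp: k_def)
  qed
  have hA: "h \<in> A" using kA[of 0] by (simp add: k_def)
  obtain u v where hu: "h = torus_elt u v" using torus_torus_elt h by blast
  have h0: "h = 0"
  proof (rule torus_faithful[OF h(1)])
    fix a x assume a: "a \<in> P" and x: "x \<in> rspace a"
    have "br x h \<in> A" using A(3) rspace_borel a x hA by blast
    then have "br h (br x h) = 0" using A(4) hA by blast
    moreover have hx: "br h x = sc (weight u v a) x" using hu br_torus_elt x by blast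
    then have "br x h = - sc (weight u v a) x" using br_anti[of x h] by simp
    ultimately have "sc (weight u v a * weight u v a) x = 0" using hx by (simp add: br_minus_right br_scale_right)
    then show "br h x = 0" using hx by auto
  qed
  have "f a \<in> root_sum sc br H (ideal_roots sc br H \<Delta> B A)" if a: "a \<in> P" for a
  proof (cases "f a = 0")
    case True
    then show ?thesis using subspace_0[OF subspace_root_sum] by simp
  next
    case False
    have "a \<noteq> 0" using a z0 by blast
    then have fa: "f a \<in> A" using kA[of a] a by (simp add: k_def)
    obtain e where e: "e \<in> rspace a" "e \<noteq> 0" "\<And>x. x \<in> rspace a \<Longrightarrow> \<exists>c. x = sc c e"
      using root_vector[OF pos_root[OF a]] by blast
    obtain c where c: "f a = sc c e" using e(3) h(2) a by blast
    then have "c \<noteq> 0" using False by auto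
    then have "e = sc (inverse c) (f a)" using c by simp
    then have "e \<in> A" using fa subspace_scale[OF A(1)] by simp
    then have "rspace a \<subseteq> A" using e(3) subspace_scale[OF A(1)] by blast
    then have "a \<in> ideal_roots sc br H \<Delta> B A" using a by (simp add: ideal_roots_def)
    then show ?thesis using rspace_root_sum h(2) a by blast
  qed
  then have "(\<Sum>a\<in>P. f a) \<in> root_sum sc br H (ideal_roots sc br H \<Delta> B A)"
    by (intro subspace_sum[OF subspace_root_sum])
  then show "z \<in> root_sum sc br H (ideal_roots sc br H \<Delta> B A)" using h(3) h0 by simp
qed

text \<open>Combinatorial abelian ideals give abelian ideals, so an enlargement of the set of roots would
enlarge the ideal.\<close>
lemma maximal_ideal_roots:
  assumes "maximal_abelian_ideal sc br borel A" "I = ideal_roots sc br H \<Delta> B A"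
  shows "A = root_sum sc br H I" "comb_abelian_ideal \<Delta> B (insert x I) \<Longrightarrow> x \<in> I"
proof -
  have ab: "abelian_ideal sc br borel A"
    and max: "\<And>A'. abelian_ideal sc br borel A' \<Longrightarrow> A \<subseteq> A' \<Longrightarrow> A' = A"
    using assms(1) unfolding maximal_abelian_ideal_def by blast+
  have sub: "A \<subseteq> root_sum sc br H I" using abelian_ideal_in_root_sum[OF ab] assms(2) by simp
  have "subspace A" using ab by (simp add: abelian_ideal_def)
  then have "root_sum sc br H I \<subseteq> A"
    unfolding root_sum_def by (intro span_minimal) (auto simp: assms(2) ideal_roots_def)
  then show "A = root_sum sc br H I" using sub by blast
  assume J: "comb_abelian_ideal \<Delta> B (insert x I)"
  have "root_sum sc br H I \<subseteq> root_sum sc br H (insert x I)"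
    unfolding root_sum_def by (intro span_mono) blast
  then have "root_sum sc br H (insert x I) = A"
    using max[OF abelian_ideal_root_sum[OF J]] sub by blast
  then have "rspace x \<subseteq> A" using rspace_root_sum by blast
  moreover have "x \<in> P" using J by (simp add: comb_abelian_ideal_def)
  ultimately show "x \<in> I" by (simp add: assms(2) ideal_roots_def)
qed

lemma dim_root_sum:
  assumes "S \<subseteq> \<Delta>" shows "dim (root_sum sc br H S) = card S"
proof -
  have finS: "finite S" using assms finite_roots finite_subset by blast
  have "\<forall>a\<in>S. \<exists>e. e \<in> rspace a \<and> e \<noteq> 0 \<and> (\<forall>x\<in>rspace a. \<exists>c. x = sc c e)"
    using root_vector assms by (metis subsetD)
  then obtain e where e: "\<And>a. a \<in> S \<Longrightarrow> e a \<in> rspace a" "\<And>a. a \<in> S \<Longrightarrow> e a \<noteq> 0"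
    "\<And>a x. a \<in> S \<Longrightarrow> x \<in> rspace a \<Longrightarrow> \<exists>c. x = sc c (e a)"
    by metis
  have inj: "inj_on e S"
  proof (rule inj_onI, rule ccontr)
    fix a b assume ab: "a \<in> S" "b \<in> S" "e a = e b" "a \<noteq> b"
    define k where "k = (\<lambda>c. if c = a then e a else - e b)"
    have "k c \<in> rspace c" if "c \<in> {a, b}" for c
      using that e(1)[OF ab(1)] rspace_minus[OF e(1)[OF ab(2)]] by (cases "c = a") (simp_all add: k_def)
    moreover have "(\<Sum>c\<in>{a, b}. k c) = 0" using ab(3,4) by (simp add: k_def)
    ultimately have "k a = 0"
      by (intro weights_independent[of "{a, b}" k]) simp_all
    then show False using e(2) ab by (simp add: k_def)
  qed
  have ind: "independent (e ` S)"
  proof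
    assume "dependent (e ` S)"
    then obtain c where c: "\<exists>y\<in>e ` S. c y \<noteq> 0" "(\<Sum>y\<in>e ` S. sc (c y) y) = 0"
      using dependent_finite[of "e ` S"] finS by auto
    then obtain a where a: "a \<in> S" "c (e a) \<noteq> 0" by blast
    have s: "(\<Sum>a\<in>S. sc (c (e a)) (e a)) = 0" using c(2) unfolding sum.reindex[OF inj] comp_def .
    have "sc (c (e a)) (e a) = 0"
      by (rule weights_independent[OF finS _ s a(1)]) (use e(1) rspace_scale in blast)
    then show False using a e(2) by simp
  qed
  have "span (e ` S) = root_sum sc br H S"
  proof
    show "span (e ` S) \<subseteq> root_sum sc br H S"
      unfolding root_sum_def using e(1) by (intro span_mono) blast
    have "rspace a \<subseteq> span (e ` S)" if a: "a \<in> S" for a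
    proof
      fix x assume "x \<in> rspace a"
      then obtain c where "x = sc c (e a)" using e(3) a by blast
      then show "x \<in> span (e ` S)" using span_scale[OF span_base] a by blast
    qed
    then show "root_sum sc br H S \<subseteq> span (e ` S)"
      unfolding root_sum_def by (intro span_minimal subspace_span) blast
  qed
  then show ?thesis
    using dim_span_eq_card_independent[OF ind] card_image[OF inj] by simp
qed

end

section \<open>Minimal inversion complete sets from maximal abelian ideals\<close>

theorem theorem0p1:
  fixes sc :: "complex \<Rightarrow> 'g::ab_group_add \<Rightarrow> 'g"
    and br :: "'g \<Rightarrow> 'g \<Rightarrow> 'g"
    and H :: "'v::euclidean_space \<Rightarrow> 'g"
    and \<Delta> B I :: "'v set"
    and \<theta> \<alpha> :: 'v
    and \<aa> :: "'g set"
    and F :: "('v \<Rightarrow> 'v) set"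
  assumes "simple_lie_algebra sc br"
    and "root_system \<Delta>"
    and "simple_roots \<Delta> B"
    and "triangular_decomposition sc br H \<Delta> B"
    and "highest_root \<Delta> B \<theta>"
    and "simply_laced \<Delta>"
    and "maximal_abelian_ideal sc br (borel_subalg sc br H \<Delta> B) \<aa>"
    and I_def: "I = ideal_roots sc br H \<Delta> B \<aa>"
    and "\<alpha> \<in> B"
    and "is_fibre_max \<Delta> B \<theta> \<alpha> I"
    and F_def: "F = w_tilde \<Delta> B \<alpha> ` I"
  shows "min_inv_complete \<Delta> B F \<and>
     card F = vector_space.dim sc \<aa> \<and> vector_space.dim sc \<aa> = card I \<and>
     I \<subseteq> Ess \<Delta> B F"
proof -
  have fibre: "I \<in> tau_fibre \<Delta> B \<theta> \<alpha>"
    using assms(10) unfolding is_fibre_max_def by blast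
  interpret lie: ade_lie_algebra sc br \<Delta> B \<theta> H
    using assms by (intro ade_lie_algebra.intro ade_root_system.intro ade_lie_algebra_axioms.intro)
  note ideal = lie.maximal_ideal_roots[OF assms(7) I_def]
  interpret ideal: ade_maximal_ideal \<Delta> B \<theta> \<alpha> I
    using fibre ideal(2) assms(9) by unfold_locales
  have "I \<subseteq> \<Delta>"
    using ideal.ideal_root by blast
  then have "vector_space.dim sc \<aa> = card I"
    using ideal(1) lie.dim_root_sum by simp
  then show ?thesis
    unfolding F_def using ideal.minimal_inversion_complete by simp
qed

end
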